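(* There exist absolute constants $C,c_1>0$ such that the following holds. Let $\Phi:\mathbb{R}^d\to\mathbb{R}$, $\Phi(x) = W^{(1)}\,\mathrm{ReLU}(W^{(0)}x + b^{(0)}) + b^{(1)}$, be a random shallow ReLU network of width $N$, where $W^{(0)}\in\mathbb{R}^{N\times d}$ has i.i.d. $\mathcal{N}(0,2/N)$ entries, $W^{(1)}\in\mathbb{R}^{1\times N}$ has i.i.d. $\mathcal{N}(0,1)$ entries, $b^{(0)}_i\sim\mathcal{D}^{(0)}_i$, $b^{(1)}\sim\mathcal{D}^{(1)}_1$ for arbitrary probability distributions on $\mathbb{R}$, all jointly independent. Let $k=\min\{d,N\}$. Then: (1) for all $u,t\ge0$, $\mathrm{Lip}(\Phi)\le C\big(1+\frac{\sqrt d+t}{\sqrt N}\big)(\sqrt k+u)$ with probability at least $(1-2\exp(-u^2))_+(1-2\exp(-c_1t^2))_+$; (2) $\mathbb{E}[\mathrm{Lip}(\Phi)]\le C\big(1+\frac{\sqrt d}{\sqrt N}\big)\sqrt k$.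
   Context: $\mathrm{ReLU}(t)=\max\{0,t\}$ componentwise; $\mathrm{Lip}(f)=\sup_{x\neq y}|f(x)-f(y)|/\|x-y\|_2$; $a_+=\max\{0,a\}$. *)

theory Defs
  imports "HOL-Probability.Probability"
begin

definition Rd :: "nat \<Rightarrow> (nat \<Rightarrow> real) set" where
  "Rd d = {x. \<forall>i\<ge>d. x i = 0}"

definition eucl_dist :: "nat \<Rightarrow> (nat \<Rightarrow> real) \<Rightarrow> (nat \<Rightarrow> real) \<Rightarrow> real" where
  "eucl_dist d x y = sqrt (\<Sum>i<d. (x i - y i)^2)"

definition Lip :: "nat \<Rightarrow> ((nat \<Rightarrow> real) \<Rightarrow> real) \<Rightarrow> real" where
  "Lip d f = Sup {\<bar>f x - f y\<bar> / eucl_dist d x y | x y. x \<in> Rd d \<and> y \<in> Rd d \<and> x \<noteq> y}"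

definition relu :: "real \<Rightarrow> real" where
  "relu t = max 0 t"

definition shallow_net ::
  "nat \<Rightarrow> nat \<Rightarrow> (nat \<times> nat \<Rightarrow> real) \<Rightarrow> (nat \<Rightarrow> real) \<Rightarrow> (nat \<Rightarrow> real) \<Rightarrow> real
   \<Rightarrow> (nat \<Rightarrow> real) \<Rightarrow> real" where
  "shallow_net d N W0 b0 W1 b1 x =
     (\<Sum>i<N. W1 i * relu ((\<Sum>j<d. W0 (i, j) * x j) + b0 i)) + b1"

definition gaussian :: "real \<Rightarrow> real \<Rightarrow> real measure" where
  "gaussian \<mu> \<sigma> = density lborel (normal_density \<mu> \<sigma>)"

text \<open>Joint law of the parameters ((W0, b0), (W1, b1)): all independent,
  W0 entries N(0, 2/N), W1 entries N(0,1), b0 i ~ D0 i, b1 ~ D1.\<close>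
definition param_measure ::
  "nat \<Rightarrow> nat \<Rightarrow> (nat \<Rightarrow> real measure) \<Rightarrow> real measure
   \<Rightarrow> (((nat \<times> nat \<Rightarrow> real) \<times> (nat \<Rightarrow> real)) \<times> ((nat \<Rightarrow> real) \<times> real)) measure" where
  "param_measure d N D0 D1 =
     ((\<Pi>\<^sub>M ij\<in>{..<N} \<times> {..<d}. gaussian 0 (sqrt (2 / real N))) \<Otimes>\<^sub>M (\<Pi>\<^sub>M i\<in>{..<N}. D0 i))
     \<Otimes>\<^sub>M ((\<Pi>\<^sub>M i\<in>{..<N}. gaussian 0 1) \<Otimes>\<^sub>M D1)"

definition net_lip ::
  "nat \<Rightarrow> nat \<Rightarrow> (((nat \<times> nat \<Rightarrow> real) \<times> (nat \<Rightarrow> real)) \<times> ((nat \<Rightarrow> real) \<times> real)) \<Rightarrow> real" where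
  "net_lip d N \<omega> = (case \<omega> of ((W0, b0), (W1, b1)) \<Rightarrow> Lip d (shallow_net d N W0 b0 W1 b1))"

end

theory Submission
  imports Defs
begin

text \<open>
  Since \<open>relu (p + q) - relu p = \<integral>\<^sub>0\<^sup>1 q 1[p + t q > 0] dt\<close>, the Lipschitz constant is at most the
  supremum over points \<open>x\<close> and unit vectors \<open>v\<close> of \<open>\<bar>\<Sum>i\<in>A. a\<^sub>i \<langle>w\<^sub>i, v\<rangle>\<bar>\<close>, where \<open>A\<close> is the set of neurons
  that are active at \<open>x\<close>. Lattice nets of size \<open>48\<^sup>n\<close> discretise the unit balls and give a random
  variable \<open>X\<close> comparable to the operator norm of the inner weights, with
  \<open>E exp (N X\<^sup>2 / 8) \<le> exp (6 (N + d))\<close>. Conditionally on the inner weights and biases,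
  \<open>Y = Lip / X\<close> satisfies \<open>E exp (Y\<^sup>2 / 576) \<le> exp (50 min {d, N})\<close>: for \<open>N \<le> d\<close> this is the trivial
  bound by the norm of \<open>a\<close>; for \<open>d \<le> N\<close> the activation patterns form a class of VC dimension at most
  \<open>d\<close>, so their packing numbers with respect to the weights \<open>\<langle>w\<^sub>i, v\<rangle>\<^sup>2\<close> are at most
  \<open>(8 / \<delta>)\<^sup>2\<^sup>d\<close>, and dyadic chaining over the patterns loses no logarithm.
  The two exponential moments give the tail bound by Markov's inequality, using
  \<open>1 - a - b \<ge> (1 - 2 a) (1 - 2 b)\<close> for \<open>0 \<le> a, b \<le> 1/2\<close>, and the mean by AM-GM applied to \<open>X Y\<close>.
\<close>

subsection \<open>Packing numbers of activation patterns\<close>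

text \<open>For \<open>d \<le> N\<close> there can be as many as \<open>(N / d) ^ d\<close>
  activation patterns, and a union bound over them would cost a factor of order
  \<open>sqrt (ln (N / d))\<close>. Chaining avoids it: in the weights that belong to a direction,
  the number of patterns at resolution \<delta> is bounded independently of \<open>N\<close>, and
  its logarithm grows only linearly with the dyadic level. Dividing by \<open>X\<close> makes these
  weights sum to at most 1, so the bound for \<open>Y\<close> is uniform in the inner weights and
  all biases; this is why arbitrary bias laws are admissible. \<open>X\<close> and \<open>Y\<close>
  remain dependent, so the tails are joined by a union bound and the mean by AM-GM, neither of which
  asks for independence. Norming nets suffice because every norm that occurs is a maximum of linear
  forms over a ball. In \<open>576 = 24^2\<close> the 24 is \<open>2 * 2 * 6\<close>: one 2 for the
  net of directions, one for the discretised operator norm, and 6 from chaining.\<close>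

definition shatters :: "'a set set \<Rightarrow> 'a set \<Rightarrow> bool" where
  "shatters F S \<longleftrightarrow> (\<forall>T\<subseteq>S. \<exists>A\<in>F. A \<inter> S = T)"

text \<open>Pajor's form of the Sauer-Shelah lemma. Deleting \<open>x\<close> merges exactly the
  pairs \<open>B\<close>, \<open>insert x B\<close> that both lie in \<open>F\<close>, so
  \<open>F\<close> is counted by its traces \<open>F1\<close> plus the merged sets
  \<open>F2\<close>. Sets shattered by \<open>F1\<close> avoid \<open>x\<close>, while those
  shattered by \<open>F2\<close> can be enlarged by \<open>x\<close>, so the two contributions do
  not overlap.\<close>

lemma card_le_card_shattered:
  assumes "finite I" "F \<subseteq> Pow I"
  shows "card F \<le> card {S \<in> Pow I. shatters F S}"
  using assms
proof (induction I arbitrary: F rule: finite_induct)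
  case empty
  show ?case
  proof (cases "F = {}")
    case False
    with empty have "F = {{}}" by auto
    then have "{S \<in> Pow {}. shatters F S} = {{}}" by (auto simp: shatters_def)
    with \<open>F = {{}}\<close> show ?thesis by simp
  qed auto
next
  case (insert x I)
  define F1 where "F1 = (\<lambda>A. A - {x}) ` F"
  define F2 where "F2 = {B \<in> Pow I. B \<in> F \<and> insert x B \<in> F}"
  have finF: "finite F" using insert by (meson finite_Pow_iff finite_insert finite_subset)
  have F1: "F1 \<subseteq> Pow I" "F2 \<subseteq> Pow I" using insert by (auto simp: F1_def F2_def)
  have split: "F = {A\<in>F. x \<notin> A} \<union> {A\<in>F. x \<in> A}" by auto
  have c: "card F = card {A\<in>F. x \<notin> A} + card {A\<in>F. x \<in> A}"
    using finF by (subst split, subst card_Un_disjoint) auto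
  have c2: "card {A\<in>F. x \<in> A} = card ((\<lambda>A. A - {x}) ` {A\<in>F. x \<in> A})"
    by (rule card_image[symmetric]) (auto simp: inj_on_def)
  have "F1 = {A\<in>F. x \<notin> A} \<union> (\<lambda>A. A - {x}) ` {A\<in>F. x \<in> A}"
  proof -
    have "F1 = (\<lambda>A. A - {x}) ` {A\<in>F. x \<notin> A} \<union> (\<lambda>A. A - {x}) ` {A\<in>F. x \<in> A}"
      unfolding F1_def using split by (metis image_Un)
    moreover have "(\<lambda>A. A - {x}) ` {A\<in>F. x \<notin> A} = (\<lambda>A. A) ` {A\<in>F. x \<notin> A}"
      by (rule image_cong) auto
    ultimately show ?thesis by simp
  qed
  moreover have "F2 = {A\<in>F. x \<notin> A} \<inter> (\<lambda>A. A - {x}) ` {A\<in>F. x \<in> A}"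
  proof -
    have "B \<in> (\<lambda>A. A - {x}) ` {A\<in>F. x \<in> A}" if "insert x B \<in> F" "x \<notin> B" for B
      using that by (intro image_eqI[of _ _ "insert x B"]) auto
    moreover have "insert x (A - {x}) = A" if "x \<in> A" for A using that by auto
    ultimately show ?thesis using insert(2,4) by (auto simp: F2_def)
  qed
  ultimately have cF: "card F = card F1 + card F2"
    using c c2 finF card_Un_Int[of "{A\<in>F. x \<notin> A}" "(\<lambda>A. A - {x}) ` {A\<in>F. x \<in> A}"] by simp
  let ?S1 = "{S \<in> Pow I. shatters F1 S}" and ?S2 = "{S \<in> Pow I. shatters F2 S}"
  have "card F \<le> card ?S1 + card ?S2"
    using cF insert.IH[OF F1(1)] insert.IH[OF F1(2)] by simp
  also have "card ?S2 = card (insert x ` ?S2)"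
    using insert(2) by (intro card_image[symmetric]) (force simp: inj_on_def)
  also have "card ?S1 + card (insert x ` ?S2) = card (?S1 \<union> insert x ` ?S2)"
  proof (rule card_Un_disjoint[symmetric])
    show "?S1 \<inter> insert x ` ?S2 = {}" using insert(2) by blast
  qed (use insert(1) in simp_all)
  also have "\<dots> \<le> card {S \<in> Pow (insert x I). shatters F S}"
  proof (rule card_mono)
    have "shatters F S" if "S \<subseteq> I" "shatters F1 S" for S
      unfolding shatters_def
    proof (intro allI impI)
      fix T assume "T \<subseteq> S"
      then have "\<exists>B\<in>F1. B \<inter> S = T" using that(2) unfolding shatters_def by blast
      then obtain A where "A \<in> F" "(A - {x}) \<inter> S = T" unfolding F1_def by blast
      moreover have "(A - {x}) \<inter> S = A \<inter> S" using that insert(2) by auto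
      ultimately show "\<exists>A\<in>F. A \<inter> S = T" by auto
    qed
    moreover have "shatters F (insert x S)" if "S \<subseteq> I" "shatters F2 S" for S
      unfolding shatters_def
    proof (intro allI impI)
      fix T assume T: "T \<subseteq> insert x S"
      then have "T - {x} \<subseteq> S" by auto
      then have "\<exists>B\<in>F2. B \<inter> S = T - {x}" using that(2) unfolding shatters_def by blast
      then obtain B where B: "B \<subseteq> I" "B \<in> F" "insert x B \<in> F" "B \<inter> S = T - {x}"
        unfolding F2_def by blast
      show "\<exists>A\<in>F. A \<inter> insert x S = T"
      proof (cases "x \<in> T")
        case True
        then show ?thesis using B T by (intro bexI[of _ "insert x B"]) auto
      next
        case False
        then show ?thesis using B T insert(2) by (intro bexI[of _ B]) auto
      qed
    qed
    ultimately show "?S1 \<union> insert x ` ?S2 \<subseteq> {S \<in> Pow (insert x I). shatters F S}" by blast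
  qed (use insert(1) in auto)
  finally show ?case .
qed

lemma sum_Pow_power_card:
  fixes x :: "'b::comm_semiring_1"
  assumes "finite I"
  shows "(\<Sum>S\<in>Pow I. x ^ card S) = (1 + x) ^ card I"
  using assms
proof (induction I)
  case (insert a I)
  have "(\<Sum>S\<in>Pow (insert a I). x ^ card S)
      = (\<Sum>S\<in>Pow I. x ^ card S) + (\<Sum>S\<in>insert a ` Pow I. x ^ card S)"
    unfolding Pow_insert
  proof (rule sum.union_disjoint)
    show "Pow I \<inter> insert a ` Pow I = {}" using insert(2) by blast
  qed (use insert(1) in simp_all)
  also have "(\<Sum>S\<in>insert a ` Pow I. x ^ card S) = (\<Sum>S\<in>Pow I. x ^ card (insert a S))"
  proof -
    have "inj_on (insert a) (Pow I)"
      using insert(2) by (intro inj_onI) (metis Diff_insert_absorb PowD subsetD)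
    then show ?thesis by (simp add: sum.reindex)
  qed
  also have "\<dots> = (\<Sum>S\<in>Pow I. x * x ^ card S)"
  proof (rule sum.cong)
    fix S assume S: "S \<in> Pow I"
    with insert have "finite S" "a \<notin> S" by (auto intro: finite_subset)
    then show "x ^ card (insert a S) = x * x ^ card S" by simp
  qed simp
  finally show ?case using insert by (simp add: sum_distrib_left[symmetric] algebra_simps)
qed simp

text \<open>Since \<open>l \<le> 1\<close>, each shattered set has
  \<open>l ^ card S \<ge> l ^ d\<close>, and a generating function replaces the sum of binomial
  coefficients. Keeping \<open>l\<close> free lets \<open>packing_bound\<close> tie it to the
  resolution \<delta>.\<close>

lemma Sauer_Shelah_exp:
  fixes l :: real
  assumes "finite I" "F \<subseteq> Pow I" and vc: "\<And>S. S \<subseteq> I \<Longrightarrow> shatters F S \<Longrightarrow> card S \<le> d"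
    and l: "0 < l" "l \<le> 1"
  shows "l ^ d * real (card F) \<le> exp (l * real (card I))"
proof -
  have "l ^ d * real (card F) \<le> l ^ d * real (card {S \<in> Pow I. shatters F S})"
    using card_le_card_shattered[OF assms(1,2)] l by (intro mult_left_mono) auto
  also have "\<dots> = (\<Sum>S | S \<in> Pow I \<and> shatters F S. l ^ d)" by simp
  also have "\<dots> \<le> (\<Sum>S | S \<in> Pow I \<and> shatters F S. l ^ card S)"
    using vc l by (intro sum_mono power_decreasing) auto
  also have "\<dots> \<le> (\<Sum>S\<in>Pow I. l ^ card S)"
    using assms(1) l by (intro sum_mono2) auto
  also have "\<dots> = (1 + l) ^ card I" by (rule sum_Pow_power_card[OF assms(1)])
  also have "\<dots> \<le> exp l ^ card I" using l by (intro power_mono) auto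
  also have "\<dots> = exp (l * real (card I))" by (simp add: exp_of_nat_mult[symmetric] mult.commute)
  finally show ?thesis .
qed

section \<open>Linear dependence and the VC dimension of half-space patterns\<close>

lemma exists_linear_dependence:
  fixes w :: "'i \<Rightarrow> nat \<Rightarrow> real"
  assumes "finite I" "card I > d"
  shows "\<exists>c. (\<exists>i\<in>I. c i \<noteq> 0) \<and> (\<forall>j<d. (\<Sum>i\<in>I. c i * w i j) = 0)"
  using assms
proof (induction d arbitrary: I w)
  case 0
  then obtain p where "p \<in> I" by (auto simp: card_gt_0_iff)
  then show ?case by (intro exI[of _ "\<lambda>_. 1"]) auto
next
  case (Suc d)
  show ?case
  proof (cases "\<forall>i\<in>I. w i d = 0")
    case True
    from Suc.IH[of I w] Suc.prems obtain c where
      "\<exists>i\<in>I. c i \<noteq> 0" "\<forall>j<d. (\<Sum>i\<in>I. c i * w i j) = 0" by auto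
    with True show ?thesis by (auto simp: less_Suc_eq intro!: exI[of _ c])
  next
    case False
    then obtain p where p: "p \<in> I" "w p d \<noteq> 0" by auto
    \<comment> \<open>Gaussian elimination: the pivot \<open>p\<close> clears coordinate
      \<open>d\<close> in the other vectors, and \<open>s\<close> is the coefficient of the pivot
      that undoes the elimination.\<close>
    define w' where "w' i j = w i j - w i d / w p d * w p j" for i j
    have "card (I - {p}) > d" using p Suc.prems by simp
    with Suc.IH[of "I - {p}" w'] Suc.prems obtain c where
      c: "\<exists>i\<in>I - {p}. c i \<noteq> 0" "\<forall>j<d. (\<Sum>i\<in>I - {p}. c i * w' i j) = 0" by auto
    define s where "s = - (\<Sum>i\<in>I - {p}. c i * w i d / w p d)"
    have eq: "(\<Sum>i\<in>I. (c(p := s)) i * w i j) = (\<Sum>i\<in>I - {p}. c i * w' i j)" for j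
    proof -
      have "(\<Sum>i\<in>I. (c(p := s)) i * w i j) = s * w p j + (\<Sum>i\<in>I - {p}. (c(p := s)) i * w i j)"
        using p Suc.prems by (subst sum.remove[of I p]) auto
      also have "(\<Sum>i\<in>I - {p}. (c(p := s)) i * w i j) = (\<Sum>i\<in>I - {p}. c i * w i j)"
        by (intro sum.cong) auto
      finally show ?thesis
        by (simp add: w'_def s_def sum_subtractf right_diff_distrib sum_distrib_right mult.assoc)
    qed
    have "w' i d = 0" for i using p by (simp add: w'_def)
    then have "\<forall>j<Suc d. (\<Sum>i\<in>I. (c(p := s)) i * w i j) = 0"
      using c(2) unfolding eq by (auto simp: less_Suc_eq)
    moreover have "\<exists>i\<in>I. (c(p := s)) i \<noteq> 0" using c(1) by auto
    ultimately show ?thesis by blast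
  qed
qed

definition active :: "nat \<Rightarrow> nat \<Rightarrow> (nat \<times> nat \<Rightarrow> real) \<Rightarrow> (nat \<Rightarrow> real) \<Rightarrow> (nat \<Rightarrow> real) \<Rightarrow> nat set" where
  "active d N W b x = {i. i < N \<and> (\<Sum>j<d. W (i, j) * x j) + b i > 0}"

lemma active_subset: "active d N W b x \<subseteq> {..<N}"
  by (auto simp: active_def)

text \<open>A dependence \<open>c\<close> among the weight vectors makes the sum of
  \<open>c i * f x i\<close> independent of \<open>x\<close>. A point whose pattern on
  \<open>S\<close> is \<open>{i\<in>S. c i > 0}\<close> makes all terms non-negative, so this
  constant is non-negative, and positive as soon as some \<open>c i > 0\<close>. The same for
  \<open>- c\<close> forces \<open>c = 0\<close>. Only \<open>x\<close> varies while the biases are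
  fixed, which is why the bound is \<open>d\<close> and not \<open>d + 1\<close>.\<close>

lemma card_le_if_shatters_active:
  assumes S: "S \<subseteq> {..<N}" and sh: "shatters (range (active d N W b)) S"
  shows "card S \<le> d"
proof (rule ccontr)
  assume "\<not> card S \<le> d"
  moreover have fin: "finite S" using S finite_subset by blast
  ultimately obtain c where c: "\<exists>i\<in>S. c i \<noteq> 0" "\<forall>j<d. (\<Sum>i\<in>S. c i * W (i, j)) = 0"
    using exists_linear_dependence[of S d "\<lambda>i j. W (i, j)"] by auto
  define f where "f x i = (\<Sum>j<d. W (i, j) * x j) + b i" for x :: "nat \<Rightarrow> real" and i
  have orth: "(\<Sum>i\<in>S. c' i * f x i) = (\<Sum>i\<in>S. c' i * b i)"
    if "\<forall>j<d. (\<Sum>i\<in>S. c' i * W (i, j)) = 0" for c' x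
  proof -
    have "(\<Sum>i\<in>S. c' i * (\<Sum>j<d. W (i, j) * x j)) = (\<Sum>j<d. \<Sum>i\<in>S. c' i * W (i, j) * x j)"
      by (subst sum.swap) (simp add: sum_distrib_left mult.assoc)
    also have "\<dots> = 0" using that by (simp add: sum_distrib_right[symmetric])
    finally show ?thesis by (simp add: f_def distrib_left sum.distrib)
  qed
  have nonneg: "(\<Sum>i\<in>S. c' i * b i) \<ge> 0 \<and> ((\<exists>i\<in>S. c' i > 0) \<longrightarrow> (\<Sum>i\<in>S. c' i * b i) > 0)"
    if o: "\<forall>j<d. (\<Sum>i\<in>S. c' i * W (i, j)) = 0" for c'
  proof -
    from sh have "\<exists>A\<in>range (active d N W b). A \<inter> S = {i\<in>S. c' i > 0}"
      by (auto simp: shatters_def)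
    then obtain x where x: "active d N W b x \<inter> S = {i\<in>S. c' i > 0}" by auto
    have pos: "f x i > 0 \<longleftrightarrow> c' i > 0" if "i \<in> S" for i
      using x S that by (auto simp: active_def f_def)
    have ge: "c' i * f x i \<ge> 0" if "i \<in> S" for i
      using pos[OF that] by (cases "c' i > 0") (auto simp: zero_le_mult_iff)
    have "(\<Sum>i\<in>S. c' i * f x i) > 0" if "i \<in> S" "c' i > 0" for i
      using ge pos that fin by (intro sum_pos2[of _ i]) auto
    moreover have "(\<Sum>i\<in>S. c' i * f x i) \<ge> 0" using ge by (intro sum_nonneg)
    ultimately show ?thesis using orth[OF o, of x] by auto
  qed
  have c': "\<forall>j<d. (\<Sum>i\<in>S. - c i * W (i, j)) = 0"
    using c(2) by (simp add: sum_negf)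
  have "(\<Sum>i\<in>S. - c i * b i) = - (\<Sum>i\<in>S. c i * b i)" by (simp add: sum_negf)
  with nonneg[OF c(2)] nonneg[OF c'] have "\<not> (\<exists>i\<in>S. c i > 0)" "\<not> (\<exists>i\<in>S. - c i > 0)" by linarith+
  with c(1) show False by (metis neg_0_less_iff_less linorder_neqE_linordered_idom)
qed

section \<open>Packing and covering of a VC class in a weighted symmetric difference\<close>

definition sdiff :: "'a set \<Rightarrow> 'a set \<Rightarrow> 'a set" where
  "sdiff A B = (A - B) \<union> (B - A)"

text \<open>Greedy choice of coordinates: by averaging, some coordinate splits at least a fraction
  \<open>\<delta>\<close> of the pairs that are not yet told apart.\<close>

lemma greedy_separation:
  fixes q :: "'a \<Rightarrow> real"
  assumes I: "finite I" and q: "\<And>i. i \<in> I \<Longrightarrow> q i \<ge> 0" "sum q I \<le> 1"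
    and F: "F \<subseteq> Pow I" and \<delta>: "0 \<le> \<delta>" "\<delta> \<le> 1"
    and sep: "\<And>A B. A \<in> F \<Longrightarrow> B \<in> F \<Longrightarrow> A \<noteq> B \<Longrightarrow> sum q (sdiff A B) > \<delta>"
  shows "\<exists>J\<subseteq>I. card J \<le> n \<and>
    real (card {(A,B)\<in>F\<times>F. A \<noteq> B \<and> A \<inter> J = B \<inter> J}) \<le> (1 - \<delta>) ^ n * (real (card F))\<^sup>2"
proof (induction n)
  case 0
  have "finite F" using F I by (meson finite_Pow_iff finite_subset)
  then have "card {(A,B)\<in>F\<times>F. A \<noteq> B} \<le> card (F \<times> F)" by (intro card_mono) auto
  then have "real (card {(A,B)\<in>F\<times>F. A \<noteq> B}) \<le> (real (card F))\<^sup>2"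
    by (simp add: card_cartesian_product power2_eq_square flip: of_nat_mult)
  then show ?case by (intro exI[of _ "{}"]) auto
next
  case (Suc n)
  have finF: "finite F" using F I by (meson finite_Pow_iff finite_subset)
  obtain J where J: "J \<subseteq> I" "card J \<le> n"
    "real (card {(A,B)\<in>F\<times>F. A \<noteq> B \<and> A \<inter> J = B \<inter> J}) \<le> (1 - \<delta>) ^ n * (real (card F))\<^sup>2"
    using Suc.IH by blast
  define R where "R = {(A,B)\<in>F\<times>F. A \<noteq> B \<and> A \<inter> J = B \<inter> J}"
  have finR: "finite R" unfolding R_def using finF by (simp add: finite_subset[of _ "F \<times> F"] subset_eq)
  have RD: "fst p \<in> F \<and> snd p \<in> F \<and> fst p \<noteq> snd p" if "p \<in> R" for p
    using that unfolding R_def by (cases p) simp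
  define h where "h i = {p \<in> R. i \<in> sdiff (fst p) (snd p)}" for i
  show ?case
  proof (cases "R = {}")
    case True
    then have "real (card {(A,B)\<in>F\<times>F. A \<noteq> B \<and> A \<inter> J = B \<inter> J}) = 0"
      unfolding R_def by (simp only: card.empty of_nat_0)
    moreover have "0 \<le> (1 - \<delta>) ^ Suc n * (real (card F))\<^sup>2" using \<delta> by (intro mult_nonneg_nonneg zero_le_power) auto
    ultimately show ?thesis using J by (intro exI[of _ J]) auto
  next
    case False
    have sub: "sdiff (fst p) (snd p) \<subseteq> I" if "p \<in> R" for p
    proof -
      have "fst p \<subseteq> I" "snd p \<subseteq> I" using RD[OF that] F by blast+
      then show ?thesis by (auto simp: sdiff_def)
    qed
    have "\<delta> * real (card R) = (\<Sum>p\<in>R. \<delta>)" by simp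
    also have "\<dots> < (\<Sum>p\<in>R. sum q (sdiff (fst p) (snd p)))"
  proof (rule sum_strict_mono[OF finR False])
      fix p assume "p \<in> R"
      from RD[OF this] show "\<delta> < sum q (sdiff (fst p) (snd p))" using sep by simp
    qed
    also have "\<dots> = (\<Sum>p\<in>R. \<Sum>i\<in>I. if i \<in> sdiff (fst p) (snd p) then q i else 0)"
    proof (rule sum.cong)
      fix p assume "p \<in> R"
      from sub[OF this] show "sum q (sdiff (fst p) (snd p)) = (\<Sum>i\<in>I. if i \<in> sdiff (fst p) (snd p) then q i else 0)"
        using I by (simp add: sum.inter_restrict[symmetric] Int_absorb1)
    qed simp
    also have "\<dots> = (\<Sum>i\<in>I. q i * real (card (h i)))"
      using finR by (subst sum.swap) (simp add: h_def sum.inter_filter[symmetric] mult.commute)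
    finally have lt: "\<delta> * real (card R) < (\<Sum>i\<in>I. q i * real (card (h i)))" .
    have "\<exists>i\<in>I. real (card (h i)) > \<delta> * real (card R)"
    proof (rule ccontr)
      assume "\<not> ?thesis"
      then have "(\<Sum>i\<in>I. q i * real (card (h i))) \<le> (\<Sum>i\<in>I. q i * (\<delta> * real (card R)))"
        using q by (intro sum_mono mult_left_mono) (auto simp: not_less)
      also have "\<dots> = sum q I * (\<delta> * real (card R))" by (simp add: sum_distrib_right)
      also have "\<dots> \<le> 1 * (\<delta> * real (card R))" using q \<delta> by (intro mult_right_mono) auto
      finally show False using lt by simp
    qed
    then obtain i where i: "i \<in> I" "real (card (h i)) > \<delta> * real (card R)" by auto
    have eq: "{(A,B)\<in>F\<times>F. A \<noteq> B \<and> A \<inter> insert i J = B \<inter> insert i J} = R - h i"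
    proof -
      have "A \<inter> insert i J = B \<inter> insert i J \<longleftrightarrow> A \<inter> J = B \<inter> J \<and> i \<notin> sdiff A B"
        for A B unfolding sdiff_def by blast
      then have "(case p of (A, B) \<Rightarrow> (A, B) \<in> F \<times> F \<and> A \<noteq> B \<and> A \<inter> insert i J = B \<inter> insert i J)
          \<longleftrightarrow> p \<in> R - h i" for p
        unfolding R_def h_def by (cases p) (simp, blast)
      then show ?thesis by blast
    qed
    have "real (card (R - h i)) = real (card R) - real (card (h i))"
      using finR by (subst card_Diff_subset) (auto simp: h_def of_nat_diff card_mono)
    also have "\<dots> \<le> (1 - \<delta>) * real (card R)" using i by (simp add: algebra_simps)
    also have "\<dots> \<le> (1 - \<delta>) * ((1 - \<delta>) ^ n * (real (card F))\<^sup>2)"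
      using J(3) \<delta> unfolding R_def by (intro mult_left_mono) auto
    finally have "real (card (R - h i)) \<le> (1 - \<delta>) ^ Suc n * (real (card F))\<^sup>2" by (simp add: mult.assoc)
    moreover have "card (insert i J) \<le> Suc n"
      using J I by (metis Suc_le_mono card_insert_le_m1 card_insert_if finite_subset le_SucI)
    ultimately show ?thesis using J i unfolding eq[symmetric] by (intro exI[of _ "insert i J"]) auto
  qed
qed

text \<open>A Haussler-type bound free of \<open>card I\<close>. About
  \<open>2 * ln m / \<delta>\<close> greedy coordinates separate all members, so \<open>F\<close> is
  as large as its trace on these few coordinates. Sauer-Shelah there gives roughly
  \<open>m * (\<delta>/4) ^ d \<le> sqrt m\<close>, and a factor \<open>sqrt m\<close> cancels. The
  price is the exponent \<open>2 * d\<close> in place of \<open>d\<close>, harmless because only the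
  logarithm enters later.\<close>

lemma packing_bound:
  fixes q :: "'a \<Rightarrow> real"
  assumes I: "finite I" and q: "\<And>i. i \<in> I \<Longrightarrow> q i \<ge> 0" "sum q I \<le> 1"
    and F: "F \<subseteq> Pow I" and \<delta>: "0 < \<delta>" "\<delta> \<le> 1"
    and sep: "\<And>A B. A \<in> F \<Longrightarrow> B \<in> F \<Longrightarrow> A \<noteq> B \<Longrightarrow> sum q (sdiff A B) > \<delta>"
    and vc: "\<And>S. S \<subseteq> I \<Longrightarrow> shatters F S \<Longrightarrow> card S \<le> d"
    and d: "d \<ge> 1"
  shows "real (card F) \<le> (8 / \<delta>) ^ (2 * d)"
proof (cases "card F = 0")
  case True
  then show ?thesis using \<delta> by simp
next
  case False
  define m where "m = real (card F)"
  have m: "m \<ge> 1" using False by (simp add: m_def)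
  \<comment> \<open>The \<open>+ 1\<close> makes \<open>n\<close> strictly exceed
    \<open>2 * ln m / \<delta>\<close>, which pushes the bound on the number of unseparated pairs
    below 1, hence to 0.\<close>
  define n where "n = nat \<lfloor>2 * ln m / \<delta>\<rfloor> + 1"
  have n: "real n > 2 * ln m / \<delta>" "real n \<le> 2 * ln m / \<delta> + 1"
    unfolding n_def using m \<delta> real_of_int_floor_add_one_gt[of "2 * ln m / \<delta>"]
    by (auto simp: of_nat_nat add.commute)
  obtain J where J: "J \<subseteq> I" "card J \<le> n"
    "real (card {(A,B)\<in>F\<times>F. A \<noteq> B \<and> A \<inter> J = B \<inter> J}) \<le> (1 - \<delta>) ^ n * m\<^sup>2"
    using greedy_separation[OF I q F less_imp_le[OF \<delta>(1)] \<delta>(2) sep, of n] unfolding m_def by blast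
  have finF: "finite F" using F I by (meson finite_Pow_iff finite_subset)
  have "(1 - \<delta>) ^ n * m\<^sup>2 \<le> exp (- \<delta>) ^ n * m\<^sup>2"
    using \<delta> exp_ge_add_one_self[of "- \<delta>"] by (intro mult_right_mono power_mono) auto
  also have "\<dots> = exp (- \<delta> * real n + 2 * ln m)"
  proof -
    have "m\<^sup>2 = exp (2 * ln m)" using m by (simp add: exp_double)
    moreover have "exp (- \<delta>) ^ n = exp (- \<delta> * real n)"
      by (simp add: exp_of_nat_mult[symmetric] mult.commute)
    ultimately show ?thesis by (simp only: exp_add)
  qed
  also have "\<dots> < 1" using n(1) \<delta> by (simp add: field_simps)
  finally have "card {(A,B)\<in>F\<times>F. A \<noteq> B \<and> A \<inter> J = B \<inter> J} = 0" using J(3) by simp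
  moreover have "finite {(A,B)\<in>F\<times>F. A \<noteq> B \<and> A \<inter> J = B \<inter> J}"
    using finF by (simp add: finite_subset[of _ "F \<times> F"] subset_eq)
  ultimately have "{(A,B)\<in>F\<times>F. A \<noteq> B \<and> A \<inter> J = B \<inter> J} = {}" by (simp only: card_0_eq)
  then have inj: "inj_on (\<lambda>A. A \<inter> J) F" unfolding inj_on_def by blast
  define G where "G = (\<lambda>A. A \<inter> J) ` F"
  \<comment> \<open>With \<open>\<delta>/4\<close> the exponent is at most
    \<open>ln m / 2 + \<delta>/4\<close>, that is, half of the logarithm to be bounded.\<close>
  have "(\<delta>/4) ^ d * real (card G) \<le> exp (\<delta>/4 * real (card J))"
  proof (rule Sauer_Shelah_exp)
    show "finite J" using J I finite_subset by blast
    show "card S \<le> d" if S: "S \<subseteq> J" "shatters G S" for S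
    proof (rule vc)
      have "A \<inter> J \<inter> S = A \<inter> S" for A using S by auto
      then show "shatters F S" using S(2) by (auto simp: shatters_def G_def)
    qed (use S J in auto)
  qed (use \<delta> in \<open>auto simp: G_def\<close>)
  moreover have "card G = card F" unfolding G_def by (rule card_image[OF inj])
  ultimately have "(\<delta>/4) ^ d * m \<le> exp (\<delta>/4 * real (card J))" by (simp add: m_def)
  also have "\<dots> \<le> exp (\<delta>/4 * (2 * ln m / \<delta> + 1))"
    using J(2) n(2) \<delta> by simp
  also have "\<delta>/4 * (2 * ln m / \<delta> + 1) = ln m / 2 + \<delta> / 4" using \<delta> by (simp add: field_simps)
  finally have "((\<delta>/4) ^ d * m)\<^sup>2 \<le> (exp (ln m / 2 + \<delta> / 4))\<^sup>2"
    using \<delta> m by (intro power_mono) auto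
  also have "\<dots> = m * exp (\<delta> / 2)" using m by (simp add: exp_add power_mult_distrib exp_double[symmetric])
  finally have "(\<delta>/4) ^ (2 * d) * m * m \<le> exp (\<delta> / 2) * m"
    unfolding mult_2 power_add power2_eq_square by (simp add: mult_ac)
  then have "(\<delta>/4) ^ (2 * d) * m \<le> exp (\<delta> / 2)" using m by simp
  also have "\<dots> \<le> exp 1" using \<delta> by simp
  also have "\<dots> \<le> 2 ^ (2 * d)"
  proof -
    have "exp 1 \<le> (2::real) ^ 2" using exp_le by simp
    also have "\<dots> \<le> 2 ^ (2 * d)" using d by (intro power_increasing) auto
    finally show ?thesis .
  qed
  finally show ?thesis using \<delta> unfolding m_def
    by (simp add: power_divide field_simps flip: power_mult_distrib)
qed

text \<open>A separated family of maximal cardinality is a net, since a pattern far from all its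
  members could be added. It exists because \<open>N\<close> neurons have only finitely many
  patterns.\<close>

lemma exists_net:
  fixes q :: "nat \<Rightarrow> real"
  assumes q: "\<And>i. i < N \<Longrightarrow> q i \<ge> 0" "sum q {..<N} \<le> 1" and \<delta>: "0 < \<delta>" "\<delta> \<le> 1" and d: "d \<ge> 1"
  shows "\<exists>T. T \<subseteq> Pow {..<N} \<and> real (card T) \<le> (8 / \<delta>) ^ (2 * d) \<and>
    (\<forall>x. \<exists>B\<in>T. sum q (sdiff (active d N W b x) B) \<le> \<delta>)"
proof -
  let ?A = "range (active d N W b)"
  define sep where "sep F \<longleftrightarrow> F \<subseteq> ?A \<and> (\<forall>A\<in>F. \<forall>B\<in>F. A \<noteq> B \<longrightarrow> sum q (sdiff A B) > \<delta>)" for F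
  have A: "?A \<subseteq> Pow {..<N}" using active_subset by blast
  then have finA: "finite ?A" by (rule finite_subset) auto
  have "finite {F. sep F}" by (rule finite_subset[of _ "Pow ?A"]) (use finA in \<open>auto simp: sep_def\<close>)
  moreover have "{} \<in> {F. sep F}" by (simp add: sep_def)
  ultimately have fin: "finite (card ` {F. sep F})" and "card ` {F. sep F} \<noteq> {}" by blast+
  then have "Max (card ` {F. sep F}) \<in> card ` {F. sep F}" by (rule Max_in)
  then obtain F where F: "sep F" "card F = Max (card ` {F. sep F})" by auto
  have max: "card F' \<le> card F" if "sep F'" for F'
    unfolding F(2) using fin that by (intro Max_ge) auto
  have FA: "F \<subseteq> ?A" "finite F" using F finA finite_subset by (auto simp: sep_def)
  have "real (card F) \<le> (8 / \<delta>) ^ (2 * d)"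
  proof (rule packing_bound[where I="{..<N}" and q=q])
    fix S assume S: "S \<subseteq> {..<N}" "shatters F S"
    then have "shatters ?A S" using FA(1) unfolding shatters_def by (meson subsetD)
    then show "card S \<le> d" using S(1) by (rule card_le_if_shatters_active[rotated])
  next
    show "F \<subseteq> Pow {..<N}" using FA(1) A by (rule subset_trans)
    show "sum q (sdiff B C) > \<delta>" if "B \<in> F" "C \<in> F" "B \<noteq> C" for B C
      using F(1) that unfolding sep_def by blast
  qed (use q \<delta> d in simp_all)
  moreover have "\<exists>B\<in>F. sum q (sdiff (active d N W b x) B) \<le> \<delta>" for x
  proof (rule ccontr)
    let ?a = "active d N W b x"
    assume "\<not> ?thesis"
    then have *: "\<And>B. B \<in> F \<Longrightarrow> sum q (sdiff ?a B) > \<delta>" by force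
    have comm: "sdiff B ?a = sdiff ?a B" for B by (auto simp: sdiff_def)
    have "?a \<notin> F" using *[of ?a] \<delta> by (auto simp: sdiff_def)
    moreover have "sep (insert ?a F)"
      unfolding sep_def
    proof (intro conjI ballI impI)
      show "insert ?a F \<subseteq> ?A" using FA(1) by simp
      fix B C assume "B \<in> insert ?a F" "C \<in> insert ?a F" "B \<noteq> C"
      then show "sum q (sdiff B C) > \<delta>"
        using F(1) * comm unfolding sep_def by (metis insertE)
    qed
    ultimately show False using max[of "insert ?a F"] FA(2) by simp
  qed
  moreover have "F \<subseteq> Pow {..<N}" using FA(1) A by (rule subset_trans)
  ultimately show ?thesis by blast
qed

subsection \<open>Lipschitz constants of shallow networks\<close>

lemma relu_increment_has_integral:
  "((\<lambda>t. q * of_bool (p + t * q > 0)) has_integral (relu (p + q) - relu p)) {0..1}"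
proof -
  \<comment> \<open>The kink \<open>- p / q\<close> is the only exceptional point; for
    \<open>q = 0\<close> the function is constant.\<close>
  have "((\<lambda>t. q * of_bool (p + t * q > 0)) has_integral (relu (p + 1 * q) - relu (p + 0 * q))) {0..1}"
  proof (rule fundamental_theorem_of_calculus_interior_strong[where S="{- p / q}" and f="\<lambda>t. relu (p + t * q)"])
    fix t assume t: "t \<in> {0<..<1} - {- p / q}"
    show "((\<lambda>t. relu (p + t * q)) has_vector_derivative q * of_bool (p + t * q > 0)) (at t)"
    proof (cases "q = 0")
      case True
      then show ?thesis by simp
    next
      case False
      have "p + t * q \<noteq> 0"
      proof
        assume "p + t * q = 0"
        then have "t = - p / q" using False by (simp add: field_simps)
        with t show False by simp
      qed
      then consider "p + t * q > 0" | "p + t * q < 0" by linarith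
      then show ?thesis
      proof cases
        case 1
        have "((\<lambda>t. p + t * q) has_vector_derivative q) (at t)"
          unfolding has_real_derivative_iff_has_vector_derivative[symmetric]
          by (auto intro!: derivative_eq_intros)
        moreover have "open {t. p + t * q > 0}" by (intro open_Collect_less continuous_intros)
        ultimately have "((\<lambda>t. relu (p + t * q)) has_vector_derivative q) (at t)"
          by (rule has_vector_derivative_transform_within_open) (use 1 in \<open>auto simp: relu_def\<close>)
        then show ?thesis using 1 by simp
      next
        case 2
        have "open {t. p + t * q < 0}" by (intro open_Collect_less continuous_intros)
        with has_vector_derivative_const[of 0 "at t"]
        have "((\<lambda>t. relu (p + t * q)) has_vector_derivative 0) (at t)"
          by (rule has_vector_derivative_transform_within_open) (use 2 in \<open>auto simp: relu_def\<close>)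
        then show ?thesis using 2 by simp
      qed
    qed
  qed (auto simp: relu_def intro!: continuous_intros)
  then show ?thesis by simp
qed

text \<open>The derivative along \<open>v\<close> of the affine map that the network equals where
  exactly the neurons in \<open>A\<close> are active.\<close>

definition slope ::
  "nat \<Rightarrow> (nat \<times> nat \<Rightarrow> real) \<Rightarrow> (nat \<Rightarrow> real) \<Rightarrow> nat set \<Rightarrow> (nat \<Rightarrow> real) \<Rightarrow> real" where
  "slope d W a A v = (\<Sum>i\<in>A. a i * (\<Sum>j<d. W (i, j) * v j))"

text \<open>Along the segment from \<open>y\<close> to \<open>x\<close> the difference is an
  integral of slopes. The convention in \<open>active\<close> makes the integrand a slope even at
  the kinks, so differentiability of the network is never discussed.\<close>

lemma shallow_net_diff_le:
  assumes B: "\<And>x v. \<bar>slope d W a (active d N W b x) v\<bar> \<le> B * sqrt (\<Sum>j<d. (v j)\<^sup>2)"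
  shows "\<bar>shallow_net d N W b a c x - shallow_net d N W b a c y\<bar> \<le> B * eucl_dist d x y"
proof -
  define v where "v j = x j - y j" for j
  define p where "p i = (\<Sum>j<d. W (i, j) * y j) + b i" for i
  define q where "q i = (\<Sum>j<d. W (i, j) * v j)" for i
  have pq: "(\<Sum>j<d. W (i, j) * (y j + t * v j)) + b i = p i + t * q i" for i t
    by (simp add: p_def q_def distrib_left sum.distrib sum_distrib_left mult_ac)
  have diff: "shallow_net d N W b a c x - shallow_net d N W b a c y
      = (\<Sum>i<N. a i * (relu (p i + q i) - relu (p i)))"
  proof -
    have "(\<Sum>j<d. W (i, j) * x j) + b i = p i + q i" for i
      using pq[where t=1 and i=i] by (simp add: v_def)
    then show ?thesis by (simp add: shallow_net_def p_def[symmetric] sum_subtractf right_diff_distrib)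
  qed
  have int: "((\<lambda>t. \<Sum>i<N. a i * (q i * of_bool (p i + t * q i > 0)))
      has_integral (\<Sum>i<N. a i * (relu (p i + q i) - relu (p i)))) {0..1}"
    by (intro has_integral_sum has_integral_mult_right relu_increment_has_integral) auto
  have eq: "(\<Sum>i<N. a i * (q i * of_bool (p i + t * q i > 0)))
      = slope d W a (active d N W b (\<lambda>j. y j + t * v j)) v" for t
  proof -
    have "(\<Sum>i<N. a i * (q i * of_bool (p i + t * q i > 0)))
        = (\<Sum>i<N. if p i + t * q i > 0 then a i * q i else 0)" by (intro sum.cong) auto
    also have "\<dots> = (\<Sum>i | i \<in> {..<N} \<and> p i + t * q i > 0. a i * q i)"
      by (subst sum.inter_filter) auto
    finally show ?thesis by (simp add: slope_def active_def pq q_def)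
  qed
  have B0: "0 \<le> B * sqrt (\<Sum>j<d. (v j)\<^sup>2)" using B[of x v] by linarith
  have "norm (\<Sum>i<N. a i * (relu (p i + q i) - relu (p i)))
      \<le> B * sqrt (\<Sum>j<d. (v j)\<^sup>2) * measure lborel (cbox 0 (1::real))"
    by (rule has_integral_bound[OF B0, of _ _ 0 1]) (use int B in \<open>simp_all add: eq\<close>)
  then show ?thesis unfolding diff by (simp add: eucl_dist_def v_def)
qed

section \<open>The Lipschitz constant as a supremum of difference quotients\<close>

lemma eucl_dist_pos:
  assumes "x \<in> Rd d" "y \<in> Rd d" "x \<noteq> y"
  shows "eucl_dist d x y > 0"
proof -
  from assms obtain i where i: "x i \<noteq> y i" by blast
  with assms have "i < d" by (auto simp: Rd_def not_less[symmetric])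
  with i have "0 < (\<Sum>j<d. (x j - y j)\<^sup>2)" by (intro sum_pos2[of _ i]) auto
  then show ?thesis by (simp add: eucl_dist_def)
qed

text \<open>For \<open>d = 0\<close> the set of quotients in \<open>Lip\<close> is empty and its
  \<open>Sup\<close> carries no information; this is one reason for
  \<open>d \<ge> 1\<close>.\<close>

lemma Rd_nontrivial:
  assumes "d \<ge> 1"
  shows "\<exists>x y. x \<in> Rd d \<and> y \<in> Rd d \<and> x \<noteq> y"
proof (intro exI conjI)
  show "(\<lambda>i. if i = 0 then 1 else 0) \<noteq> (\<lambda>_::nat. 0::real)" by (metis one_neq_zero)
qed (use assms in \<open>auto simp: Rd_def\<close>)

lemma Lip_le:
  assumes d: "d \<ge> 1" and B: "\<And>x y. \<bar>f x - f y\<bar> \<le> B * eucl_dist d x y"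
  shows "Lip d f \<le> B"
  unfolding Lip_def
proof (rule cSup_least)
  show "{\<bar>f x - f y\<bar> / eucl_dist d x y |x y. x \<in> Rd d \<and> y \<in> Rd d \<and> x \<noteq> y} \<noteq> {}"
    using Rd_nontrivial[OF d] by blast
next
  fix r assume "r \<in> {\<bar>f x - f y\<bar> / eucl_dist d x y |x y. x \<in> Rd d \<and> y \<in> Rd d \<and> x \<noteq> y}"
  then obtain x y where "r = \<bar>f x - f y\<bar> / eucl_dist d x y" "x \<in> Rd d" "y \<in> Rd d" "x \<noteq> y" by auto
  then show "r \<le> B" using B[of x y] eucl_dist_pos[of x d y] by (simp add: pos_divide_le_eq)
qed

text \<open>\<open>Sup\<close> of an unbounded set of reals is unspecified, so some finite bound
  \<open>B\<close> has to be available before \<open>Lip\<close> can be treated as a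
  supremum.\<close>

lemma Lip_le_iff:
  assumes d: "d \<ge> 1" and B: "\<And>x y. \<bar>f x - f y\<bar> \<le> B * eucl_dist d x y"
  shows "Lip d f \<le> r \<longleftrightarrow> (\<forall>x\<in>Rd d. \<forall>y\<in>Rd d. \<bar>f x - f y\<bar> \<le> r * eucl_dist d x y)"
proof -
  let ?S = "{\<bar>f x - f y\<bar> / eucl_dist d x y |x y. x \<in> Rd d \<and> y \<in> Rd d \<and> x \<noteq> y}"
  have ne: "?S \<noteq> {}" using Rd_nontrivial[OF d] by blast
  have "bdd_above ?S"
  proof (rule bdd_aboveI[of _ B])
    fix r assume "r \<in> ?S"
    then obtain x y where "r = \<bar>f x - f y\<bar> / eucl_dist d x y" "x \<in> Rd d" "y \<in> Rd d" "x \<noteq> y" by auto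
    then show "r \<le> B" using B[of x y] eucl_dist_pos[of x d y] by (simp add: pos_divide_le_eq)
  qed
  then have "Lip d f \<le> r \<longleftrightarrow> (\<forall>s\<in>?S. s \<le> r)"
    unfolding Lip_def by (rule cSup_le_iff[OF ne])
  also have "\<dots> \<longleftrightarrow> (\<forall>x\<in>Rd d. \<forall>y\<in>Rd d. x \<noteq> y \<longrightarrow> \<bar>f x - f y\<bar> / eucl_dist d x y \<le> r)" by blast
  also have "\<dots> \<longleftrightarrow> (\<forall>x\<in>Rd d. \<forall>y\<in>Rd d. x \<noteq> y \<longrightarrow> \<bar>f x - f y\<bar> \<le> r * eucl_dist d x y)"
    using eucl_dist_pos by (auto simp: pos_divide_le_eq)
  also have "\<dots> \<longleftrightarrow> (\<forall>x\<in>Rd d. \<forall>y\<in>Rd d. \<bar>f x - f y\<bar> \<le> r * eucl_dist d x y)"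
  proof -
    have "\<bar>f x - f x\<bar> \<le> r * eucl_dist d x x" for x by (simp add: eucl_dist_def)
    then show ?thesis by metis
  qed
  finally show ?thesis .
qed

lemma Lip_nonneg:
  assumes d: "d \<ge> 1" and B: "\<And>x y. \<bar>f x - f y\<bar> \<le> B * eucl_dist d x y"
  shows "0 \<le> Lip d f"
proof -
  obtain x y where xy: "x \<in> Rd d" "y \<in> Rd d" "x \<noteq> y" using Rd_nontrivial[OF d] by blast
  have "\<bar>f x - f y\<bar> \<le> Lip d f * eucl_dist d x y"
    using Lip_le_iff[OF d B, where r="Lip d f"] xy by simp
  then have "0 \<le> Lip d f * eucl_dist d x y" by linarith
  then show ?thesis using eucl_dist_pos[OF xy] by (simp add: zero_le_mult_iff)
qed

section \<open>Rational points and measurability of the Lipschitz constant\<close>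

definition Qd :: "nat \<Rightarrow> (nat \<Rightarrow> real) set" where
  "Qd d = {x \<in> Rd d. \<forall>i. x i \<in> \<rat>}"

lemma countable_Qd: "countable (Qd d)"
proof (rule countable_subset)
  show "Qd d \<subseteq> (\<lambda>g i. if i < d then g i else 0) ` PiE {..<d} (\<lambda>_. \<rat>)"
  proof
    fix x assume "x \<in> Qd d"
    then show "x \<in> (\<lambda>g i. if i < d then g i else 0) ` PiE {..<d} (\<lambda>_. \<rat>)"
      by (intro image_eqI[of _ _ "restrict x {..<d}"]) (auto simp: Qd_def Rd_def fun_eq_iff)
  qed
  show "countable ((\<lambda>g i. if i < d then g i else 0) ` PiE {..<d} (\<lambda>_. \<rat> :: real set))"
    by (intro countable_image countable_PiE countable_rat) auto
qed

lemma Qd_dense: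
  assumes "x \<in> Rd d"
  shows "\<exists>xs. (\<forall>n. xs n \<in> Qd d) \<and> (\<forall>i. (\<lambda>n. xs n i) \<longlonglongrightarrow> x i)"
proof -
  have "\<exists>r. r \<in> \<rat> \<and> r \<in> {x i..x i + 1 / real (Suc n)} \<and> (i \<ge> d \<longrightarrow> r = 0)" for i n
  proof (cases "i < d")
    case True
    from Rats_dense_in_real[of "x i" "x i + 1 / real (Suc n)"]
    obtain r where "r \<in> \<rat>" "x i < r" "r < x i + 1 / real (Suc n)" by auto
    with True show ?thesis by (intro exI[of _ r]) auto
  next
    case False
    with assms have "x i = 0" by (auto simp: Rd_def)
    then show ?thesis by (intro exI[of _ 0]) auto
  qed
  then have "\<forall>n i. \<exists>r. r \<in> \<rat> \<and> r \<in> {x i..x i + 1 / real (Suc n)} \<and> (i \<ge> d \<longrightarrow> r = 0)" by blast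
  then obtain xs where xs: "\<And>n i. xs n i \<in> \<rat>" "\<And>n i. xs n i \<in> {x i..x i + 1 / real (Suc n)}"
    "\<And>n i. i \<ge> d \<Longrightarrow> xs n i = 0" by metis
  have "(\<lambda>n. xs n i) \<longlonglongrightarrow> x i" for i
  proof (rule tendsto_sandwich[where f="\<lambda>_. x i"])
    show "(\<lambda>n. x i + 1 / real (Suc n)) \<longlonglongrightarrow> x i"
      using tendsto_add[OF tendsto_const lim_1_over_n[THEN LIMSEQ_Suc]] by simp
  qed (use xs(2) in \<open>auto intro!: tendsto_const\<close>)
  then show ?thesis using xs by (intro exI[of _ xs]) (auto simp: Qd_def Rd_def)
qed

text \<open>Continuity, which follows from the bound \<open>B\<close>, carries the inequality to
  limits. The sublevel sets of the random Lipschitz constant thus become countable intersections of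
  measurable sets.\<close>

lemma Lip_le_iff_rational:
  assumes d: "d \<ge> 1" and B: "\<And>x y. \<bar>f x - f y\<bar> \<le> B * eucl_dist d x y"
  shows "Lip d f \<le> r \<longleftrightarrow> (\<forall>x\<in>Qd d. \<forall>y\<in>Qd d. \<bar>f x - f y\<bar> \<le> r * eucl_dist d x y)"
  unfolding Lip_le_iff[OF assms]
proof (intro iffI ballI)
  fix x y assume Q: "\<forall>x\<in>Qd d. \<forall>y\<in>Qd d. \<bar>f x - f y\<bar> \<le> r * eucl_dist d x y"
    and xy: "x \<in> Rd d" "y \<in> Rd d"
  obtain xs ys where xs: "\<And>n. xs n \<in> Qd d" "\<And>i. (\<lambda>n. xs n i) \<longlonglongrightarrow> x i"
    and ys: "\<And>n. ys n \<in> Qd d" "\<And>i. (\<lambda>n. ys n i) \<longlonglongrightarrow> y i"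
    using Qd_dense[OF xy(1)] Qd_dense[OF xy(2)] by metis
  have f: "(\<lambda>n. f (zs n)) \<longlonglongrightarrow> f z" if zs: "\<And>i. (\<lambda>n. zs n i) \<longlonglongrightarrow> z i" for zs z
  proof -
    have "(\<lambda>n. B * eucl_dist d (zs n) z) \<longlonglongrightarrow> B * eucl_dist d z z"
      unfolding eucl_dist_def by (intro tendsto_intros zs)
    then have "(\<lambda>n. B * eucl_dist d (zs n) z) \<longlonglongrightarrow> 0" by (simp add: eucl_dist_def)
    then have "(\<lambda>n. f (zs n) - f z) \<longlonglongrightarrow> 0"
      by (rule Lim_null_comparison[rotated]) (use B in auto)
    then show ?thesis by (simp add: LIM_zero_iff)
  qed
  have "(\<lambda>n. \<bar>f (xs n) - f (ys n)\<bar>) \<longlonglongrightarrow> \<bar>f x - f y\<bar>"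
    by (intro tendsto_intros f xs ys)
  moreover have "(\<lambda>n. r * eucl_dist d (xs n) (ys n)) \<longlonglongrightarrow> r * eucl_dist d x y"
    unfolding eucl_dist_def by (intro tendsto_intros xs ys)
  ultimately show "\<bar>f x - f y\<bar> \<le> r * eucl_dist d x y"
    by (rule LIMSEQ_le) (use Q xs ys in auto)
qed (auto simp: Qd_def)

text \<open>A crude bound, there only to guarantee that the supremum in \<open>Lip\<close> is finite
  for every realisation of the parameters.\<close>

lemma shallow_net_Lipschitz:
  "\<exists>B. \<forall>x y. \<bar>shallow_net d N W b a c x - shallow_net d N W b a c y\<bar> \<le> B * eucl_dist d x y"
proof -
  define B where "B = (\<Sum>i<N. \<bar>a i\<bar> * (\<Sum>j<d. \<bar>W (i, j)\<bar>))"
  have "\<bar>slope d W a (active d N W b x) v\<bar> \<le> B * sqrt (\<Sum>j<d. (v j)\<^sup>2)" for x v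
  proof -
    let ?r = "sqrt (\<Sum>j<d. (v j)\<^sup>2)"
    have v: "\<bar>v j\<bar> \<le> ?r" if "j < d" for j
      using that member_le_sum[of j "{..<d}" "\<lambda>j. (v j)\<^sup>2"] by (auto intro!: real_le_rsqrt)
    have "\<bar>slope d W a (active d N W b x) v\<bar>
        \<le> (\<Sum>i\<in>active d N W b x. \<bar>a i * (\<Sum>j<d. W (i, j) * v j)\<bar>)"
      unfolding slope_def by (rule sum_abs)
    also have "\<dots> \<le> (\<Sum>i<N. \<bar>a i * (\<Sum>j<d. W (i, j) * v j)\<bar>)"
      using active_subset by (intro sum_mono2) auto
    also have "\<dots> \<le> (\<Sum>i<N. \<bar>a i\<bar> * ((\<Sum>j<d. \<bar>W (i, j)\<bar>) * ?r))"
    proof (rule sum_mono)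
      fix i
      have "\<bar>\<Sum>j<d. W (i, j) * v j\<bar> \<le> (\<Sum>j<d. \<bar>W (i, j) * v j\<bar>)" by (rule sum_abs)
      also have "\<dots> \<le> (\<Sum>j<d. \<bar>W (i, j)\<bar> * ?r)"
        unfolding abs_mult using v by (intro sum_mono mult_left_mono) auto
      finally show "\<bar>a i * (\<Sum>j<d. W (i, j) * v j)\<bar> \<le> \<bar>a i\<bar> * ((\<Sum>j<d. \<bar>W (i, j)\<bar>) * ?r)"
        unfolding abs_mult sum_distrib_right by (intro mult_left_mono) auto
    qed
    finally show ?thesis by (simp add: B_def sum_distrib_right mult.assoc)
  qed
  then show ?thesis using shallow_net_diff_le by blast
qed

lemma net_lip_nonneg: "d \<ge> 1 \<Longrightarrow> 0 \<le> net_lip d N \<omega>"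
  unfolding net_lip_def split_beta using shallow_net_Lipschitz Lip_nonneg by metis

lemma net_lip_measurable:
  assumes d: "d \<ge> 1"
    and [measurable_cong]: "sets PW = sets (\<Pi>\<^sub>M ij\<in>{..<N} \<times> {..<d}. borel)"
      "sets Pb = sets (\<Pi>\<^sub>M i\<in>{..<N}. borel)" "sets Pa = sets (\<Pi>\<^sub>M i\<in>{..<N}. borel)" "sets Pc = sets borel"
  shows "net_lip d N \<in> borel_measurable ((PW \<Otimes>\<^sub>M Pb) \<Otimes>\<^sub>M (Pa \<Otimes>\<^sub>M Pc))" (is "_ \<in> borel_measurable ?M")
proof (rule borel_measurableI_le)
  fix r
  define f where "f \<omega> = shallow_net d N (fst (fst \<omega>)) (snd (fst \<omega>)) (fst (snd \<omega>)) (snd (snd \<omega>))"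
    for \<omega> :: "((nat \<times> nat \<Rightarrow> real) \<times> (nat \<Rightarrow> real)) \<times> ((nat \<Rightarrow> real) \<times> real)"
  have [measurable]: "(\<lambda>\<omega>. f \<omega> x) \<in> borel_measurable ?M" for x
    unfolding f_def shallow_net_def relu_def by measurable
  have "net_lip d N \<omega> \<le> r \<longleftrightarrow> (\<forall>x\<in>Qd d. \<forall>y\<in>Qd d. \<bar>f \<omega> x - f \<omega> y\<bar> \<le> r * eucl_dist d x y)" for \<omega>
  proof -
    obtain B where B: "\<And>x y. \<bar>f \<omega> x - f \<omega> y\<bar> \<le> B * eucl_dist d x y"
      unfolding f_def using shallow_net_Lipschitz by metis
    have "net_lip d N \<omega> = Lip d (f \<omega>)" by (simp add: net_lip_def f_def split_beta)
    then show ?thesis using Lip_le_iff_rational[OF d B] by simp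
  qed
  then have "{\<omega> \<in> space ?M. net_lip d N \<omega> \<le> r}
      = {\<omega> \<in> space ?M. \<forall>x\<in>Qd d. \<forall>y\<in>Qd d. \<bar>f \<omega> x - f \<omega> y\<bar> \<le> r * eucl_dist d x y}" by simp
  also have "\<dots> \<in> sets ?M"
    by (intro sets.sets_Collect_countable_All' countable_Qd) measurable
  finally show "{\<omega> \<in> space ?M. net_lip d N \<omega> \<le> r} \<in> sets ?M" .
qed

subsection \<open>Exponential moments of Gaussian linear forms\<close>

lemma sets_gaussian [measurable_cong, simp]: "sets (gaussian \<mu> \<sigma>) = sets borel"
  by (simp add: gaussian_def)

lemma measurable_PiM_gaussian_component:
  assumes "i \<in> I"
  shows "(\<lambda>x. x i) \<in> borel_measurable (\<Pi>\<^sub>M i\<in>I. gaussian \<mu> \<sigma>)"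
  unfolding measurable_cong_sets[OF refl sets_gaussian[symmetric, of \<mu> \<sigma>]]
  by (rule measurable_component_singleton[OF assms])

lemma prob_space_gaussian: "\<sigma> > 0 \<Longrightarrow> prob_space (gaussian \<mu> \<sigma>)"
  unfolding gaussian_def by (rule prob_space_normal_density)

lemma nn_integral_normal_density:
  assumes "\<sigma> > 0"
  shows "(\<integral>\<^sup>+ x. ennreal (normal_density \<mu> \<sigma> x) \<partial>lborel) = 1"
proof -
  interpret prob_space "density lborel (normal_density \<mu> \<sigma>)"
    by (rule prob_space_normal_density[OF assms])
  show ?thesis using emeasure_space_1 by (simp add: emeasure_density)
qed

lemma gaussian_mgf:
  assumes "\<sigma> > 0"
  shows "(\<integral>\<^sup>+ x. ennreal (exp (l * x)) \<partial>gaussian 0 \<sigma>) = ennreal (exp (l\<^sup>2 * \<sigma>\<^sup>2 / 2))"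
proof -
  have eq: "normal_density 0 \<sigma> x * exp (l * x)
      = exp (l\<^sup>2 * \<sigma>\<^sup>2 / 2) * normal_density (l * \<sigma>\<^sup>2) \<sigma> x" for x
    using assms by (simp add: normal_density_def exp_add[symmetric] field_simps power2_eq_square)
  have "(\<integral>\<^sup>+ x. ennreal (exp (l * x)) \<partial>gaussian 0 \<sigma>)
      = (\<integral>\<^sup>+ x. ennreal (normal_density 0 \<sigma> x) * ennreal (exp (l * x)) \<partial>lborel)"
    unfolding gaussian_def by (subst nn_integral_density) auto
  also have "\<dots> = (\<integral>\<^sup>+ x. ennreal (exp (l\<^sup>2 * \<sigma>\<^sup>2 / 2)) * ennreal (normal_density (l * \<sigma>\<^sup>2) \<sigma> x) \<partial>lborel)"
    by (simp add: ennreal_mult[symmetric] eq)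
  also have "\<dots> = ennreal (exp (l\<^sup>2 * \<sigma>\<^sup>2 / 2))"
    by (simp add: nn_integral_cmult nn_integral_normal_density[OF assms])
  finally show ?thesis .
qed

text \<open>The factor cancels half of the Gaussian exponent and leaves a normal density of variance
  2. The moment is finite only for multiples of the square below 1/2, hence the 1/4.\<close>

lemma gaussian_exp_square:
  "(\<integral>\<^sup>+ x. ennreal (exp (x\<^sup>2 / 4)) \<partial>gaussian 0 1) = ennreal (sqrt 2)"
proof -
  have eq: "normal_density 0 1 x * exp (x\<^sup>2 / 4) = sqrt 2 * normal_density 0 (sqrt 2) x" for x
    by (simp add: normal_density_def exp_add[symmetric] field_simps real_sqrt_mult)
  have "(\<integral>\<^sup>+ x. ennreal (exp (x\<^sup>2 / 4)) \<partial>gaussian 0 1)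
      = (\<integral>\<^sup>+ x. ennreal (normal_density 0 1 x) * ennreal (exp (x\<^sup>2 / 4)) \<partial>lborel)"
    unfolding gaussian_def by (subst nn_integral_density) auto
  also have "\<dots> = (\<integral>\<^sup>+ x. ennreal (sqrt 2) * ennreal (normal_density 0 (sqrt 2) x) \<partial>lborel)"
    by (simp add: ennreal_mult[symmetric] eq)
  also have "\<dots> = ennreal (sqrt 2)"
    by (simp add: nn_integral_cmult nn_integral_normal_density)
  finally show ?thesis .
qed

text \<open>The square in the exponent is linearised by an auxiliary standard Gaussian \<open>h\<close>:
  \<open>exp (s\<^sup>2 / 4) = E exp (s h / \<surd>2)\<close>.\<close>

lemma gaussian_linear_form_exp_square:
  fixes c :: "'i \<Rightarrow> real"
  assumes I: "finite I" and \<sigma>: "\<sigma> > 0" and c: "(\<Sum>i\<in>I. (c i)\<^sup>2) * \<sigma>\<^sup>2 \<le> 1"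
  shows "(\<integral>\<^sup>+ x. ennreal (exp ((\<Sum>i\<in>I. c i * x i)\<^sup>2 / 4)) \<partial>(\<Pi>\<^sub>M i\<in>I. gaussian 0 \<sigma>)) \<le> 2"
proof -
  let ?P = "\<Pi>\<^sub>M i\<in>I. gaussian 0 \<sigma>" and ?g = "gaussian 0 1"
  interpret g: prob_space ?g by (rule prob_space_gaussian) simp
  interpret g\<sigma>: prob_space "gaussian 0 \<sigma>" by (rule prob_space_gaussian) fact
  interpret P: product_prob_space "\<lambda>_. gaussian 0 \<sigma>" I by standard
  interpret PP: prob_space ?P by (rule prob_space_PiM) (rule g\<sigma>.prob_space_axioms)
  interpret pair_sigma_finite ?P ?g by standard
  have "(\<integral>\<^sup>+ x. ennreal (exp ((\<Sum>i\<in>I. c i * x i)\<^sup>2 / 4)) \<partial>?P)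
      = (\<integral>\<^sup>+ x. \<integral>\<^sup>+ h. ennreal (exp ((\<Sum>i\<in>I. c i * x i) / sqrt 2 * h)) \<partial>?g \<partial>?P)"
    by (subst gaussian_mgf) (simp_all add: power_divide)
  also have "\<dots> = (\<integral>\<^sup>+ h. \<integral>\<^sup>+ x. ennreal (exp ((\<Sum>i\<in>I. c i * x i) / sqrt 2 * h)) \<partial>?P \<partial>?g)"
    supply measurable_PiM_gaussian_component[measurable]
    by (rule Fubini'[symmetric]) measurable
  also have "\<dots> = (\<integral>\<^sup>+ h. ennreal (exp (h\<^sup>2 * ((\<Sum>i\<in>I. (c i)\<^sup>2) * \<sigma>\<^sup>2) / 4)) \<partial>?g)"
  proof (rule nn_integral_cong)
    fix h :: real
    have "(\<integral>\<^sup>+ x. ennreal (exp ((\<Sum>i\<in>I. c i * x i) / sqrt 2 * h)) \<partial>?P)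
        = (\<integral>\<^sup>+ x. (\<Prod>i\<in>I. ennreal (exp (c i / sqrt 2 * h * x i))) \<partial>?P)"
    proof (rule nn_integral_cong)
      fix x :: "'i \<Rightarrow> real"
      have "(\<Sum>i\<in>I. c i * x i) / sqrt 2 * h = (\<Sum>i\<in>I. c i / sqrt 2 * h * x i)"
        unfolding sum_divide_distrib sum_distrib_right by (intro sum.cong) (auto simp: field_simps)
      then show "ennreal (exp ((\<Sum>i\<in>I. c i * x i) / sqrt 2 * h))
          = (\<Prod>i\<in>I. ennreal (exp (c i / sqrt 2 * h * x i)))"
        using I by (simp add: prod_ennreal exp_sum)
    qed
    also have "\<dots> = (\<Prod>i\<in>I. \<integral>\<^sup>+ y. ennreal (exp (c i / sqrt 2 * h * y)) \<partial>gaussian 0 \<sigma>)"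
      by (rule P.product_nn_integral_prod[OF I]) measurable
    also have "\<dots> = (\<Prod>i\<in>I. ennreal (exp ((c i / sqrt 2 * h)\<^sup>2 * \<sigma>\<^sup>2 / 2)))"
      using \<sigma> by (simp only: gaussian_mgf)
    also have "\<dots> = ennreal (exp (\<Sum>i\<in>I. (c i / sqrt 2 * h)\<^sup>2 * \<sigma>\<^sup>2 / 2))"
      using I by (simp add: prod_ennreal exp_sum)
    also have "(\<Sum>i\<in>I. (c i / sqrt 2 * h)\<^sup>2 * \<sigma>\<^sup>2 / 2) = h\<^sup>2 * ((\<Sum>i\<in>I. (c i)\<^sup>2) * \<sigma>\<^sup>2) / 4"
      by (simp add: power_mult_distrib power_divide sum_divide_distrib sum_distrib_right sum_distrib_left mult_ac)
    finally show "(\<integral>\<^sup>+ x. ennreal (exp ((\<Sum>i\<in>I. c i * x i) / sqrt 2 * h)) \<partial>?P)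
        = ennreal (exp (h\<^sup>2 * ((\<Sum>i\<in>I. (c i)\<^sup>2) * \<sigma>\<^sup>2) / 4))" .
  qed
  also have "\<dots> \<le> (\<integral>\<^sup>+ h. ennreal (exp (h\<^sup>2 / 4)) \<partial>?g)"
    using c by (intro nn_integral_mono ennreal_leI) (simp add: mult_left_le)
  also have "\<dots> = ennreal (sqrt 2)" by (rule gaussian_exp_square)
  also have "\<dots> \<le> ennreal 2" by (intro ennreal_leI) (simp add: real_le_lsqrt)
  finally show ?thesis by simp
qed

lemma gaussian_vector_exp_square:
  "(\<integral>\<^sup>+ x. ennreal (exp ((\<Sum>i<N. (x i)\<^sup>2) / 4)) \<partial>(\<Pi>\<^sub>M i\<in>{..<N}. gaussian 0 1)) \<le> ennreal (exp (real N))"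
proof -
  interpret g: prob_space "gaussian 0 1" by (rule prob_space_gaussian) simp
  interpret P: product_prob_space "\<lambda>_. gaussian 0 1" "{..<N}" by standard
  have "(\<integral>\<^sup>+ x. ennreal (exp ((\<Sum>i<N. (x i)\<^sup>2) / 4)) \<partial>(\<Pi>\<^sub>M i\<in>{..<N}. gaussian 0 1))
      = (\<integral>\<^sup>+ x. (\<Prod>i<N. ennreal (exp ((x i)\<^sup>2 / 4))) \<partial>(\<Pi>\<^sub>M i\<in>{..<N}. gaussian 0 1))"
    by (simp add: prod_ennreal exp_sum[symmetric] sum_divide_distrib)
  also have "\<dots> = (\<Prod>i<N. \<integral>\<^sup>+ y. ennreal (exp (y\<^sup>2 / 4)) \<partial>gaussian 0 1)"
    by (rule P.product_nn_integral_prod) auto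
  also have "\<dots> = ennreal (sqrt 2 ^ N)"
    by (simp only: gaussian_exp_square prod_constant card_lessThan) (simp add: ennreal_power)
  also have "\<dots> \<le> ennreal (exp 1 ^ N)"
  proof (intro ennreal_leI power_mono)
    have "sqrt 2 \<le> 2" by (simp add: real_le_lsqrt)
    also have "\<dots> \<le> exp 1" using exp_ge_add_one_self[of 1] by simp
    finally show "sqrt 2 \<le> exp 1" .
  qed simp
  finally show ?thesis by (simp add: exp_of_nat_mult[symmetric])
qed

subsection \<open>Norming nets of the Euclidean ball\<close>

lemma sum_half_power_abs:
  "(\<Sum>j\<in>{- int m..int m}. (1/2::real) ^ nat \<bar>j\<bar>) = 3 - 2 * (1/2) ^ m"
proof (induction m)
  case (Suc m)
  have "{- int (Suc m)..int (Suc m)} = insert (int (Suc m)) (insert (- int (Suc m)) {- int m..int m})"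
    by auto
  then show ?case using Suc by (simp add: nat_add_distrib)
qed simp

text \<open>Every counted point has product weight at least \<open>(1/2) ^ K\<close>, while the
  total weight of the box factors into \<open>n\<close> two-sided geometric sums, each at most
  3.\<close>

lemma card_small_lattice_points:
  "card {z \<in> PiE {..<n} (\<lambda>_. {- int K..int K}). (\<Sum>i<n. \<bar>z i\<bar>) \<le> int K} \<le> 3 ^ n * 2 ^ K"
    (is "card ?Z \<le> _")
proof -
  let ?P = "PiE {..<n} (\<lambda>_. {- int K..int K})"
  have fin: "finite ?P" by (intro finite_PiE) auto
  have "real (card ?Z) * (1/2) ^ K = (\<Sum>z\<in>?Z. (1/2) ^ K)" by simp
  also have "\<dots> \<le> (\<Sum>z\<in>?Z. \<Prod>i<n. (1/2) ^ nat \<bar>z i\<bar>)"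
  proof (rule sum_mono)
    fix z assume "z \<in> ?Z"
    then have "int (\<Sum>i<n. nat \<bar>z i\<bar>) \<le> int K" by simp
    then have "(\<Sum>i<n. nat \<bar>z i\<bar>) \<le> K" by linarith
    then show "(1/2::real) ^ K \<le> (\<Prod>i<n. (1/2) ^ nat \<bar>z i\<bar>)"
      unfolding power_sum[symmetric] by (intro power_decreasing) auto
  qed
  also have "\<dots> \<le> (\<Sum>z\<in>?P. \<Prod>i<n. (1/2) ^ nat \<bar>z i\<bar>)"
    using fin by (intro sum_mono2 prod_nonneg) auto
  also have "\<dots> = (\<Prod>i<n. \<Sum>j\<in>{- int K..int K}. (1/2) ^ nat \<bar>j\<bar>)"
    by (rule prod_sum_PiE[symmetric]) auto
  also have "\<dots> \<le> (\<Prod>i<n. 3)"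
    unfolding sum_half_power_abs
  proof (intro prod_mono conjI)
    have "(1/2::real) ^ K \<le> 1" by (intro power_le_one) auto
    then show "0 \<le> 3 - 2 * (1/2::real) ^ K" by simp
  qed simp
  finally have "real (card ?Z) \<le> 3 ^ n * 2 ^ K" by (simp add: power_divide field_simps)
  then have "real (card ?Z) \<le> real (3 ^ n * 2 ^ K)" by simp
  then show ?thesis by (simp only: of_nat_le_iff)
qed

text \<open>Rounding towards zero keeps the squared norm from growing and loses at most
  \<open>\<bar>t\<bar> \<le> t\<^sup>2 / 4 + 1\<close> in the inner product. The additive 1 is
  affordable because the vectors to be rounded have mean squared coordinate 4.\<close>

lemma exists_rounding:
  fixes t :: real
  shows "\<exists>z::int. real_of_int (z\<^sup>2) \<le> t\<^sup>2 \<and> real_of_int z * t \<ge> 3/4 * t\<^sup>2 - 1"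
proof -
  have pos: "\<exists>z::int. real_of_int (z\<^sup>2) \<le> t\<^sup>2 \<and> real_of_int z * t \<ge> 3/4 * t\<^sup>2 - 1" if "t \<ge> 0" for t :: real
  proof (intro exI conjI)
    have fl: "0 \<le> real_of_int \<lfloor>t\<rfloor>" "real_of_int \<lfloor>t\<rfloor> \<le> t" "t - 1 \<le> real_of_int \<lfloor>t\<rfloor>"
      using that real_of_int_floor_add_one_ge[of t] by auto
    show "real_of_int (\<lfloor>t\<rfloor>\<^sup>2) \<le> t\<^sup>2" using fl by (simp add: power_mono)
    have "(t - 1) * t \<le> real_of_int \<lfloor>t\<rfloor> * t" using fl that by (intro mult_right_mono) auto
    moreover have "0 \<le> (t / 2 - 1)\<^sup>2" by simp
    ultimately show "real_of_int \<lfloor>t\<rfloor> * t \<ge> 3/4 * t\<^sup>2 - 1"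
      by (simp add: power2_eq_square algebra_simps)
  qed
  show ?thesis
  proof (cases "t \<ge> 0")
    case False
    with pos[of "- t"] obtain z :: int where "real_of_int (z\<^sup>2) \<le> t\<^sup>2" "real_of_int z * - t \<ge> 3/4 * t\<^sup>2 - 1"
      by auto
    then show ?thesis by (intro exI[of _ "- z"]) auto
  qed (rule pos)
qed

text \<open>Weaker than a metric net: only norms have to be attained, up to the factor 2. The 48 is
  \<open>3 * 2 ^ 4\<close>, the lattice count in dimension \<open>n\<close> with radius
  \<open>4 * n\<close>.\<close>

definition norming_net :: "nat \<Rightarrow> (nat \<Rightarrow> real) set \<Rightarrow> bool" where
  "norming_net n T \<longleftrightarrow> finite T \<and> T \<noteq> {} \<and> card T \<le> 48 ^ n \<and>
    (\<forall>w\<in>T. (\<Sum>i<n. (w i)\<^sup>2) \<le> 1) \<and>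
    (\<forall>y. \<exists>w\<in>T. sqrt (\<Sum>i<n. (y i)\<^sup>2) \<le> 2 * (\<Sum>i<n. w i * y i))"

text \<open>The lattice points \<open>z / (2 \<surd>n)\<close> in the unit ball. Since \<open>\<bar>z\<^sub>i\<bar> \<le> z\<^sub>i\<^sup>2\<close> for integers, they lie in
  an \<open>\<ell>\<^sub>1\<close> ball of radius \<open>4 n\<close>, where lattice points can be counted by a product of geometric series.\<close>

lemma exists_norming_net:
  assumes n: "n \<ge> 1"
  shows "\<exists>T. norming_net n T"
proof -
  define P where "P = PiE {..<n} (\<lambda>_. {- int (4 * n)..int (4 * n)})"
  define Z where "Z = {z \<in> P. (\<Sum>i<n. \<bar>z i\<bar>) \<le> int (4 * n) \<and> (\<Sum>i<n. (z i)\<^sup>2) \<le> int (4 * n)}"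
  define s where "s = 2 * sqrt (real n)"
  have s: "s > 0" "s\<^sup>2 = 4 * real n" using n by (auto simp: s_def power_mult_distrib)
  define emb where "emb z i = real_of_int (z i) / s" for z :: "nat \<Rightarrow> int" and i :: nat
  have finP: "finite P" unfolding P_def by (intro finite_PiE) auto
  have Z: "finite Z" "Z \<subseteq> {z \<in> P. (\<Sum>i<n. \<bar>z i\<bar>) \<le> int (4 * n)}" using finP by (auto simp: Z_def)
  have "card (emb ` Z) \<le> card Z" using Z by (intro card_image_le)
  also have "\<dots> \<le> card {z \<in> P. (\<Sum>i<n. \<bar>z i\<bar>) \<le> int (4 * n)}"
    using Z finP by (intro card_mono) auto
  also have "\<dots> \<le> 3 ^ n * 2 ^ (4 * n)" unfolding P_def by (rule card_small_lattice_points)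
  also have "\<dots> = 48 ^ n" by (simp add: power_mult power_mult_distrib[symmetric])
  finally have card: "card (emb ` Z) \<le> 48 ^ n" .
  have ball: "(\<Sum>i<n. (emb z i)\<^sup>2) \<le> 1" if "z \<in> Z" for z
  proof -
    have "(\<Sum>i<n. (emb z i)\<^sup>2) = real_of_int (\<Sum>i<n. (z i)\<^sup>2) / s\<^sup>2"
      by (simp add: emb_def power_divide sum_divide_distrib)
    also have "\<dots> \<le> real_of_int (int (4 * n)) / s\<^sup>2"
      using that unfolding Z_def by (intro divide_right_mono) (simp_all only: of_int_le_iff mem_Collect_eq zero_le_power2)
    also have "\<dots> = 1" using s n by simp
    finally show ?thesis .
  qed
  have dual: "\<exists>z\<in>Z. sqrt (\<Sum>i<n. (y i)\<^sup>2) \<le> 2 * (\<Sum>i<n. emb z i * y i)" for y :: "nat \<Rightarrow> real"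
  proof -
    define r where "r = sqrt (\<Sum>i<n. (y i)\<^sup>2)"
    have r: "r \<ge> 0" "r\<^sup>2 = (\<Sum>i<n. (y i)\<^sup>2)" by (auto simp: r_def sum_nonneg)
    \<comment> \<open>Rescaled to length \<open>s\<close>, so that rounding leaves an inner product
      of at least \<open>3/4 * s\<^sup>2 - n = s\<^sup>2 / 2\<close>. For \<open>r = 0\<close>
      division by zero makes \<open>t\<close> vanish.\<close>
    define t where "t i = s * y i / r" for i
    have "\<forall>i. \<exists>z::int. real_of_int (z\<^sup>2) \<le> (t i)\<^sup>2 \<and> real_of_int z * t i \<ge> 3/4 * (t i)\<^sup>2 - 1"
      using exists_rounding by blast
    then obtain z where z: "\<And>i. real_of_int ((z i)\<^sup>2) \<le> (t i)\<^sup>2"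
      "\<And>i. real_of_int (z i) * t i \<ge> 3/4 * (t i)\<^sup>2 - 1" by metis
    have "(\<Sum>i<n. (t i)\<^sup>2) = s\<^sup>2 * (\<Sum>i<n. (y i)\<^sup>2) / r\<^sup>2"
      by (simp add: t_def power_divide power_mult_distrib sum_divide_distrib sum_distrib_left)
    then have t2: "(\<Sum>i<n. (t i)\<^sup>2) = s\<^sup>2 * (r\<^sup>2 / r\<^sup>2)" by (simp add: r(2))
    moreover have "\<dots> \<le> 4 * real n" using s by simp
    ultimately have t2le: "(\<Sum>i<n. (t i)\<^sup>2) \<le> 4 * real n" by simp
    \<comment> \<open>Members of \<open>PiE\<close> are \<open>undefined\<close> outside the index
      set, hence the restriction.\<close>
    define z' where "z' = restrict z {..<n}"
    have "real_of_int (\<Sum>i<n. (z i)\<^sup>2) \<le> (\<Sum>i<n. (t i)\<^sup>2)"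
      unfolding of_int_sum using z by (intro sum_mono)
    with t2le have zsq: "(\<Sum>i<n. (z i)\<^sup>2) \<le> int (4 * n)" by linarith
    have abs: "\<bar>a\<bar> \<le> a\<^sup>2" for a :: int
    proof (cases "a = 0")
      case False
      then have "\<bar>a\<bar> * 1 \<le> \<bar>a\<bar> * \<bar>a\<bar>" by (intro mult_left_mono) auto
      then show ?thesis by (simp add: power2_eq_square)
    qed simp
    then have zabs: "(\<Sum>i<n. \<bar>z i\<bar>) \<le> int (4 * n)"
      using zsq sum_mono[of "{..<n}" "\<lambda>i. \<bar>z i\<bar>" "\<lambda>i. (z i)\<^sup>2"] by force
    have "\<bar>z i\<bar> \<le> int (4 * n)" if "i < n" for i
      using zabs member_le_sum[of i "{..<n}" "\<lambda>i. \<bar>z i\<bar>"] that by force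
    then have "z' \<in> P" by (force simp: P_def z'_def)
    moreover have "(\<Sum>i<n. \<bar>z' i\<bar>) = (\<Sum>i<n. \<bar>z i\<bar>)" "(\<Sum>i<n. (z' i)\<^sup>2) = (\<Sum>i<n. (z i)\<^sup>2)"
      by (auto simp: z'_def intro!: sum.cong)
    ultimately have "z' \<in> Z" using zsq zabs by (simp add: Z_def)
    moreover have "r \<le> 2 * (\<Sum>i<n. emb z' i * y i)"
    proof (cases "r = 0")
      case True
      then have "y i = 0" if "i < n" for i
        using r(2) that by (simp add: sum_nonneg_eq_0_iff)
      then show ?thesis using True by simp
    next
      case False
      then have r0: "r > 0" using r by simp
      have "emb z' i * y i = r / s\<^sup>2 * (real_of_int (z i) * t i)" if "i < n" for i
        using that r0 s(1) by (simp add: emb_def z'_def t_def power2_eq_square)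
      then have "(\<Sum>i<n. emb z' i * y i) = r / s\<^sup>2 * (\<Sum>i<n. real_of_int (z i) * t i)"
        by (simp add: sum_distrib_left)
      also have "\<dots> \<ge> r / s\<^sup>2 * (\<Sum>i<n. 3/4 * (t i)\<^sup>2 - 1)"
        using z(2) r0 by (intro mult_left_mono sum_mono) auto
      also have "(\<Sum>i<n. 3/4 * (t i)\<^sup>2 - 1) = 3/4 * s\<^sup>2 - real n"
        unfolding sum_subtractf sum_distrib_left[symmetric] using t2 r0 by simp
      also have "r / s\<^sup>2 * (3/4 * s\<^sup>2 - real n) = r / 2"
        using s n by (simp add: field_simps)
      finally show ?thesis by simp
    qed
    ultimately show ?thesis unfolding r_def by blast
  qed
  have "Z \<noteq> {}" using dual by blast
  then show ?thesis using card ball dual Z(1)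
    unfolding norming_net_def by (intro exI[of _ "emb ` Z"]) auto
qed

subsection \<open>Chaining over activation patterns\<close>

lemma weighted_Cauchy_Schwarz:
  fixes s g :: "'a \<Rightarrow> real"
  assumes "\<And>j. j \<in> J \<Longrightarrow> s j \<ge> 0"
  shows "(\<Sum>j\<in>J. s j * g j)\<^sup>2 \<le> (\<Sum>j\<in>J. s j) * (\<Sum>j\<in>J. s j * (g j)\<^sup>2)"
proof -
  have "(\<Sum>j\<in>J. sqrt (s j) * (sqrt (s j) * g j))\<^sup>2
      \<le> (\<Sum>j\<in>J. (sqrt (s j))\<^sup>2) * (\<Sum>j\<in>J. (sqrt (s j) * g j)\<^sup>2)"
    by (rule Cauchy_Schwarz_ineq_sum)
  also have "(\<Sum>j\<in>J. sqrt (s j) * (sqrt (s j) * g j)) = (\<Sum>j\<in>J. s j * g j)"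
    using assms by (intro sum.cong) (auto simp: mult.assoc[symmetric])
  also have "(\<Sum>j\<in>J. (sqrt (s j))\<^sup>2) = (\<Sum>j\<in>J. s j)"
    using assms by (intro sum.cong) auto
  also have "(\<Sum>j\<in>J. (sqrt (s j) * g j)\<^sup>2) = (\<Sum>j\<in>J. s j * (g j)\<^sup>2)"
    using assms by (intro sum.cong) (auto simp: power_mult_distrib)
  finally show ?thesis .
qed

lemma sum_half_powers_le: "(\<Sum>j<J. (1/2::real) ^ Suc j) \<le> 1"
proof -
  have "(\<Sum>j<J. (1/2::real) ^ Suc j) = 1 - (1/2) ^ J" by (induction J) auto
  then show ?thesis by simp
qed

lemma sum_Suc_half_powers_le: "(\<Sum>j<J. real (Suc j) * (1/2::real) ^ Suc j) \<le> 2"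
proof -
  have "(\<Sum>j<J. real (Suc j) * (1/2::real) ^ Suc j) = 2 - (real J + 2) * (1/2) ^ J"
    by (induction J) (auto simp: field_simps)
  then show ?thesis by simp
qed

lemma sum_sdiff_triangle:
  fixes q :: "'a \<Rightarrow> real"
  assumes "finite I" "\<And>i. i \<in> I \<Longrightarrow> q i \<ge> 0" "A \<subseteq> I" "B \<subseteq> I" "C \<subseteq> I"
  shows "sum q (sdiff B C) \<le> sum q (sdiff A B) + sum q (sdiff A C)"
proof -
  have sub: "sdiff A B \<subseteq> I" "sdiff A C \<subseteq> I" using assms by (auto simp: sdiff_def)
  have fin: "finite (sdiff A B)" "finite (sdiff A C)" using sub assms(1) finite_subset by auto
  have "sum q (sdiff B C) \<le> sum q (sdiff A B \<union> sdiff A C)"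
    using sub fin assms(2) by (intro sum_mono2) (auto simp: sdiff_def)
  also have "\<dots> = sum q (sdiff A B) + sum q (sdiff A C) - sum q (sdiff A B \<inter> sdiff A C)"
    using fin by (rule sum_Un)
  also have "\<dots> \<le> sum q (sdiff A B) + sum q (sdiff A C)"
  proof -
    have "0 \<le> sum q (sdiff A B \<inter> sdiff A C)" using sub assms(2) by (intro sum_nonneg) blast
    then show ?thesis by simp
  qed
  finally show ?thesis .
qed

text \<open>Dyadic chaining over the activation patterns. The random variable \<open>\<Xi>\<close> collects the
  exponential moments of all links, divided by the number of links of their level, so that
  every link of level \<open>j\<close> is bounded by \<open>ln \<Xi>\<close> plus the entropy of that level.\<close>

lemma chaining:
  fixes c :: "nat \<Rightarrow> real"
  assumes c: "(\<Sum>i<N. (c i)\<^sup>2) \<le> 1" and d: "d \<ge> 1"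
  shows "\<exists>\<Xi>::(nat \<Rightarrow> real) \<Rightarrow> real.
    \<Xi> \<in> borel_measurable (\<Pi>\<^sub>M i\<in>{..<N}. gaussian 0 1) \<and> (\<forall>a. \<Xi> a \<ge> 1) \<and>
    (\<integral>\<^sup>+ a. ennreal (\<Xi> a) \<partial>(\<Pi>\<^sub>M i\<in>{..<N}. gaussian 0 1)) \<le> 2 \<and>
    (\<forall>x a. (\<Sum>i\<in>active d N W b x. a i * c i)\<^sup>2 / 36 \<le> ln (\<Xi> a) + 44 * real d)"
proof -
  let ?P = "\<Pi>\<^sub>M i\<in>{..<N}. gaussian 0 1"
  define q where "q i = (c i)\<^sup>2" for i
  have q: "\<And>i. q i \<ge> 0" "sum q {..<N} \<le> 1" using c by (auto simp: q_def)
  let ?A = "active d N W b"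
  have "\<forall>j. \<exists>T. T \<subseteq> Pow {..<N} \<and> real (card T) \<le> (8 / (1/4) ^ j) ^ (2 * d) \<and>
      (\<forall>x. \<exists>B\<in>T. sum q (sdiff (?A x) B) \<le> (1/4) ^ j)"
    using q d by (intro allI exists_net) (auto intro: power_le_one)
  then obtain T0 where T0: "\<And>j. T0 j \<subseteq> Pow {..<N}"
    "\<And>j. real (card (T0 j)) \<le> (8 / (1/4) ^ j) ^ (2 * d)"
    "\<And>j x. \<exists>B\<in>T0 j. sum q (sdiff (?A x) B) \<le> (1/4) ^ j" by metis
  \<comment> \<open>The chain starts at the empty pattern, where the sum vanishes; this is a net of
    radius 1 because the weights sum to at most 1.\<close>
  define T where "T j = (if j = 0 then {{}} else T0 j)" for j
  have T1: "T j \<subseteq> Pow {..<N}" for j using T0 by (auto simp: T_def)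
  have T2: "real (card (T j)) \<le> 2 ^ ((2 * j + 3) * (2 * d))" for j
  proof (cases "j = 0")
    case False
    have "8 / (1/4) ^ j = (2::real) ^ 3 * (2\<^sup>2) ^ j" by (simp add: power_divide)
    also have "\<dots> = 2 ^ (2 * j + 3)" by (simp only: power_mult[symmetric] power_add[symmetric] add.commute)
    finally have "8 / (1/4) ^ j = (2::real) ^ (2 * j + 3)" .
    then show ?thesis using T0(2)[of j] False by (simp only: T_def power_mult if_False)
  qed (simp add: T_def)
  have T3: "\<exists>B\<in>T j. sum q (sdiff (?A x) B) \<le> (1/4) ^ j" for j x
  proof (cases "j = 0")
    case True
    have "sum q (?A x) \<le> sum q {..<N}" using q by (intro sum_mono2 active_subset) auto
    then show ?thesis using q True by (auto simp: T_def sdiff_def)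
  qed (use T0(3) in \<open>auto simp: T_def\<close>)
  have finT: "finite (T j)" for j using T1 by (rule finite_subset) auto
  \<comment> \<open>Links join nets of consecutive levels, and the triangle inequality gives
    \<open>(1/4) ^ Suc j + (1/4) ^ j = 5 * (1/4) ^ Suc j\<close>.\<close>
  define L where "L j = {p \<in> T (Suc j) \<times> T j. sum q (sdiff (fst p) (snd p)) \<le> 5 * (1/4) ^ Suc j}" for j
  have finL: "finite (L j)" for j using finT by (auto simp: L_def)
  \<comment> \<open>\<open>2 ^ (j + 2)\<close> times the bound in \<open>cardL\<close>. As each link
    has exponential moment at most 2, level \<open>j\<close> contributes at most
    \<open>(1/2) ^ Suc j\<close> to the integral of \<Xi>.\<close>
  define K :: "nat \<Rightarrow> real" where "K j = 2 ^ (j + 2 + (2 * j + 5) * (4 * d))" for j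
  have K: "K j > 0" for j by (simp add: K_def)
  have cardL: "real (card (L j)) \<le> 2 ^ ((2 * j + 5) * (4 * d))" for j
  proof -
    have "card (L j) \<le> card (T (Suc j) \<times> T j)" using finT by (intro card_mono) (auto simp: L_def)
    then have "real (card (L j)) \<le> real (card (T (Suc j))) * real (card (T j))"
      by (simp add: card_cartesian_product flip: of_nat_mult)
    also have "\<dots> \<le> 2 ^ ((2 * Suc j + 3) * (2 * d)) * 2 ^ ((2 * j + 3) * (2 * d))"
      by (intro mult_mono T2) auto
    also have "\<dots> = 2 ^ ((2 * Suc j + 3) * (2 * d) + (2 * j + 3) * (2 * d))"
      by (simp only: power_add)
    also have "\<dots> \<le> 2 ^ ((2 * j + 5) * (4 * d))"
      by (intro power_increasing) (auto simp: algebra_simps)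
    finally show ?thesis .
  qed
  define G where "G A a = (\<Sum>i<N. of_bool (i \<in> A) * (c i * a i))" for A :: "nat set" and a :: "nat \<Rightarrow> real"
  \<comment> \<open>Scales the link to variance at most 1: its weight is at most
    \<open>5 / 4 ^ Suc j\<close>, and 5 is rounded up to the square of 3.\<close>
  define e where "e j p i = 2 ^ Suc j / 3 * ((of_bool (i \<in> fst p) - of_bool (i \<in> snd p)) * c i)"
    for j i and p :: "nat set \<times> nat set"
  define g where "g j p a = (\<Sum>i<N. e j p i * a i)" for j p and a :: "nat \<Rightarrow> real"
  have Gg: "G (fst p) a - G (snd p) a = 3 * ((1/2) ^ Suc j * g j p a)" for j p a
    unfolding G_def g_def e_def sum_subtractf[symmetric] sum_distrib_left
    by (intro sum.cong) (auto simp: power_divide field_simps)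
  have e: "(\<Sum>i<N. (e j p i)\<^sup>2) \<le> 1" if "p \<in> L j" for j p
  proof -
    have sub: "sdiff (fst p) (snd p) \<subseteq> {..<N}"
      using that T1[of j] T1[of "Suc j"] by (fastforce simp: L_def sdiff_def)
    have "(\<Sum>i<N. (e j p i)\<^sup>2) = (\<Sum>i<N. (2 ^ Suc j / 3)\<^sup>2 * (if i \<in> sdiff (fst p) (snd p) then q i else 0))"
      by (intro sum.cong) (auto simp: e_def q_def sdiff_def power_mult_distrib power_divide)
    also have "\<dots> = (2 ^ Suc j / 3)\<^sup>2 * sum q (sdiff (fst p) (snd p))"
      using sub by (simp add: sum_distrib_left[symmetric] sum.inter_restrict[symmetric] Int_absorb1)
    also have "\<dots> \<le> (2 ^ Suc j / 3)\<^sup>2 * (5 * (1/4) ^ Suc j)"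
      using that by (intro mult_left_mono) (auto simp: L_def)
    also have "(2 ^ Suc j / 3 :: real)\<^sup>2 = 4 ^ Suc j / 9"
      by (simp only: power_divide power_mult[symmetric] mult.commute[of _ 2]) (simp add: power_mult)
    also have "4 ^ Suc j / 9 * (5 * (1/4) ^ Suc j) = (5/9::real)"
      by (simp add: power_divide)
    finally show ?thesis by simp
  qed
  \<comment> \<open>Finitely many levels suffice: within radius \<open>(1/4) ^ J\<close> a net
    element agrees with the pattern on every coordinate of positive weight, so the chain ends
    exactly and no limit is taken.\<close>
  have "\<exists>J. \<forall>i<N. q i > 0 \<longrightarrow> (1/4) ^ J < q i"
  proof -
    define m where "m = Min (insert 1 (q ` {i. i < N \<and> q i > 0}))"
    have "m > 0" unfolding m_def by (subst Min_gr_iff) auto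
    then obtain J where "(1/4::real) ^ J < m" using real_arch_pow_inv[of m "1/4"] by auto
    moreover have "m \<le> q i" if "i < N" "q i > 0" for i
      unfolding m_def using that by (intro Min_le) auto
    ultimately show ?thesis by (intro exI[of _ J]) force
  qed
  then obtain J where J: "\<And>i. i < N \<Longrightarrow> q i > 0 \<Longrightarrow> (1/4) ^ J < q i" by blast
  \<comment> \<open>The summand 1 keeps \<open>ln (\<Xi> a)\<close> non-negative.\<close>
  define \<Xi> where "\<Xi> a = 1 + (\<Sum>j<J. \<Sum>p\<in>L j. exp ((g j p a)\<^sup>2 / 4) / K j)" for a
  have [measurable]: "g j p \<in> borel_measurable ?P" for j p
    unfolding g_def by (intro borel_measurable_sum borel_measurable_times borel_measurable_const
        measurable_PiM_gaussian_component) auto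
  have \<Xi>1: "\<Xi> a \<ge> 1" for a
  proof -
    have "0 \<le> exp ((g j p a)\<^sup>2 / 4) / K j" for j p using K[of j] by simp
    then show ?thesis unfolding \<Xi>_def by (simp add: sum_nonneg)
  qed
  have "(\<integral>\<^sup>+ a. ennreal (\<Xi> a) \<partial>?P)
      = (\<integral>\<^sup>+ a. 1 + (\<Sum>j<J. \<Sum>p\<in>L j. ennreal (1 / K j) * ennreal (exp ((g j p a)\<^sup>2 / 4))) \<partial>?P)"
  proof (rule nn_integral_cong)
    fix a
    have nn: "0 \<le> exp ((g j p a)\<^sup>2 / 4) / K j" for j p using K[of j] by simp
    then have "ennreal (\<Xi> a) = 1 + (\<Sum>j<J. \<Sum>p\<in>L j. ennreal (exp ((g j p a)\<^sup>2 / 4) / K j))"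
      unfolding \<Xi>_def by (simp add: ennreal_plus sum_nonneg sum_ennreal del: ennreal_plus[symmetric])
    moreover have "ennreal (exp ((g j p a)\<^sup>2 / 4) / K j)
        = ennreal (1 / K j) * ennreal (exp ((g j p a)\<^sup>2 / 4))" for j p
      using K[of j] by (subst ennreal_mult[symmetric]) auto
    ultimately show "ennreal (\<Xi> a)
        = 1 + (\<Sum>j<J. \<Sum>p\<in>L j. ennreal (1 / K j) * ennreal (exp ((g j p a)\<^sup>2 / 4)))" by simp
  qed
  also have "\<dots> = (\<integral>\<^sup>+ a. 1 \<partial>?P)
      + (\<Sum>j<J. \<Sum>p\<in>L j. ennreal (1 / K j) * (\<integral>\<^sup>+ a. ennreal (exp ((g j p a)\<^sup>2 / 4)) \<partial>?P))"
    by (simp add: nn_integral_add nn_integral_sum nn_integral_cmult)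
  also have "(\<integral>\<^sup>+ a. 1 \<partial>?P) = 1"
    using prob_space.emeasure_space_1[OF prob_space_PiM, of "{..<N}" "\<lambda>_. gaussian 0 1"]
    by (simp add: prob_space_gaussian)
  also have "(\<Sum>j<J. \<Sum>p\<in>L j. ennreal (1 / K j) * (\<integral>\<^sup>+ a. ennreal (exp ((g j p a)\<^sup>2 / 4)) \<partial>?P))
      \<le> (\<Sum>j<J. \<Sum>p\<in>L j. ennreal (1 / K j) * 2)"
    unfolding g_def using e
    by (intro sum_mono mult_left_mono gaussian_linear_form_exp_square) auto
  also have "\<dots> = ennreal (\<Sum>j<J. real (card (L j)) * (2 / K j))"
  proof -
    have "ennreal (1 / K j) * 2 = ennreal (2 / K j)" for j
      using K[of j] ennreal_mult[of "1 / K j" 2] by simp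
    moreover have "(\<Sum>j<J. \<Sum>p\<in>L j. ennreal (2 / K j)) = (\<Sum>j<J. ennreal (\<Sum>p\<in>L j. 2 / K j))"
      using K by (intro sum.cong refl sum_ennreal) (simp add: less_imp_le)
    moreover have "\<dots> = ennreal (\<Sum>j<J. \<Sum>p\<in>L j. 2 / K j)"
      using K by (intro sum_ennreal sum_nonneg) (simp add: less_imp_le)
    ultimately show ?thesis by (simp only: sum_constant)
  qed
  also have "\<dots> \<le> ennreal 1"
  proof (rule ennreal_leI)
    have "(\<Sum>j<J. real (card (L j)) * (2 / K j)) \<le> (\<Sum>j<J. (1/2) ^ Suc j)"
    proof (rule sum_mono)
      fix j
      have "real (card (L j)) * (2 / K j) \<le> 2 ^ ((2 * j + 5) * (4 * d)) * (2 / K j)"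
        using cardL K by (intro mult_right_mono) (auto simp: less_imp_le)
      also have "\<dots> = (1/2) ^ Suc j" by (simp add: K_def power_add power_divide)
      finally show "real (card (L j)) * (2 / K j) \<le> (1/2) ^ Suc j" .
    qed
    also have "\<dots> \<le> 1" by (rule sum_half_powers_le)
    finally show "(\<Sum>j<J. real (card (L j)) * (2 / K j)) \<le> 1" .
  qed
  finally have int: "(\<integral>\<^sup>+ a. ennreal (\<Xi> a) \<partial>?P) \<le> 2"
    by (simp add: add_left_mono order_trans one_add_one)
  have link: "(g j p a)\<^sup>2 \<le> 4 * (ln (\<Xi> a) + 22 * real d * real (Suc j))"
    if "j < J" "p \<in> L j" for j p a
  proof -
    have "exp ((g j p a)\<^sup>2 / 4) / K j \<le> (\<Sum>p\<in>L j. exp ((g j p a)\<^sup>2 / 4) / K j)"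
      using that K finL by (intro member_le_sum) (auto simp: less_imp_le)
    also have "\<dots> \<le> (\<Sum>j<J. \<Sum>p\<in>L j. exp ((g j p a)\<^sup>2 / 4) / K j)"
      using that K by (intro member_le_sum sum_nonneg) (auto simp: less_imp_le)
    also have "\<dots> \<le> \<Xi> a" by (simp add: \<Xi>_def)
    finally have "exp ((g j p a)\<^sup>2 / 4) \<le> \<Xi> a * K j" using K[of j] by (simp add: pos_divide_le_eq)
    moreover have "\<Xi> a * K j > 0"
      using K[of j] \<Xi>1[of a] by (intro mult_pos_pos) linarith+
    ultimately have "(g j p a)\<^sup>2 / 4 \<le> ln (\<Xi> a * K j)"
      by (simp only: ln_ge_iff)
    also have "\<dots> = ln (\<Xi> a) + ln (K j)"
      using K[of j] \<Xi>1[of a] by (intro ln_mult_pos) auto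
    also have "ln (K j) = real (j + 2 + (2 * j + 5) * (4 * d)) * ln 2"
      unfolding K_def by (rule ln_realpow)
    also have "\<dots> \<le> real (j + 2 + (2 * j + 5) * (4 * d)) * 1"
      using ln_le_minus_one[of "2::real"] by (intro mult_left_mono) auto
    also have "\<dots> \<le> 22 * real d * real (Suc j)"
    proof -
      have "(j + 2) * 1 \<le> (j + 2) * d" using d by (intro mult_left_mono) auto
      then have "j + 2 + (2 * j + 5) * (4 * d) \<le> 22 * d * Suc j" by (simp add: algebra_simps)
      then have "real (j + 2 + (2 * j + 5) * (4 * d)) \<le> real (22 * d * Suc j)" by (simp only: of_nat_le_iff)
      then show ?thesis by (simp only: of_nat_mult of_nat_numeral mult_1_right)
    qed
    finally show ?thesis by simp
  qed
  have bound: "(\<Sum>i\<in>?A x. a i * c i)\<^sup>2 / 36 \<le> ln (\<Xi> a) + 44 * real d" for x a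
  proof -
    obtain B where B: "\<And>j. B j \<in> T j" "\<And>j. sum q (sdiff (?A x) (B j)) \<le> (1/4) ^ j"
      using T3[of _ x] by metis
    have BN: "B j \<subseteq> {..<N}" for j using B(1) T1 by blast
    define p where "p j = (B (Suc j), B j)" for j
    have pL: "p j \<in> L j" for j
    proof -
      have "sum q (sdiff (B (Suc j)) (B j)) \<le> sum q (sdiff (?A x) (B (Suc j))) + sum q (sdiff (?A x) (B j))"
        by (rule sum_sdiff_triangle[of "{..<N}"]) (use q BN active_subset in auto)
      also have "\<dots> \<le> 5 * (1/4) ^ Suc j" using B(2)[of j] B(2)[of "Suc j"] by simp
      finally show ?thesis using B(1) by (simp add: L_def p_def)
    qed
    have "(\<Sum>i\<in>?A x. a i * c i) = (\<Sum>i<N. if i \<in> ?A x then a i * c i else 0)"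
      using active_subset by (subst sum.inter_restrict[symmetric]) (auto simp: Int_absorb1)
    also have "\<dots> = G (?A x) a" unfolding G_def by (intro sum.cong) auto
    also have "\<dots> = G (B J) a"
      unfolding G_def
    proof (rule sum.cong)
      fix i assume i: "i \<in> {..<N}"
      show "of_bool (i \<in> ?A x) * (c i * a i) = of_bool (i \<in> B J) * (c i * a i)"
      proof (cases "i \<in> sdiff (?A x) (B J)")
        case True
        have "sdiff (?A x) (B J) \<subseteq> {..<N}" using BN[of J] active_subset[of d N W b x] unfolding sdiff_def by blast
        then have "finite (sdiff (?A x) (B J))" by (rule finite_subset) simp
        then have "q i \<le> sum q (sdiff (?A x) (B J))" using True q by (intro member_le_sum) auto
        then have "\<not> q i > 0" using J[of i] B(2)[of J] i by fastforce
        then show ?thesis by (simp add: q_def)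
      qed (auto simp: sdiff_def)
    qed simp
    also have "\<dots> = (\<Sum>j<J. G (B (Suc j)) a - G (B j) a)"
    proof -
      have "G (B 0) a = 0" using B(1)[of 0] by (simp add: T_def G_def)
      then show ?thesis using sum_lessThan_telescope[of "\<lambda>j. G (B j) a" J] by simp
    qed
    also have "\<dots> = 3 * (\<Sum>j<J. (1/2) ^ Suc j * g j (p j) a)"
    proof -
      have "G (B (Suc j)) a - G (B j) a = 3 * ((1/2) ^ Suc j * g j (p j) a)" for j
        using Gg[where p="p j" and j=j and a=a] by (simp only: p_def fst_conv snd_conv)
      then show ?thesis by (simp only: sum_distrib_left)
    qed
    finally have "(\<Sum>i\<in>?A x. a i * c i)\<^sup>2 = 9 * (\<Sum>j<J. (1/2) ^ Suc j * g j (p j) a)\<^sup>2"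
      by (simp add: power_mult_distrib)
    \<comment> \<open>Geometric weights beat the entropy, which is linear in the level: the two
      series are at most 1 and 2, giving
      \<open>9 * (4 * ln (\<Xi> a) + 176 * d) / 36\<close>.\<close>
    moreover have "(\<Sum>j<J. (1/2) ^ Suc j * g j (p j) a)\<^sup>2
        \<le> (\<Sum>j<J. (1/2) ^ Suc j) * (\<Sum>j<J. (1/2) ^ Suc j * (g j (p j) a)\<^sup>2)"
      by (rule weighted_Cauchy_Schwarz) simp
    moreover have "\<dots> \<le> 1 * (\<Sum>j<J. (1/2) ^ Suc j * (g j (p j) a)\<^sup>2)"
      by (intro mult_right_mono sum_half_powers_le sum_nonneg) auto
    moreover have "(\<Sum>j<J. (1/2) ^ Suc j * (g j (p j) a)\<^sup>2)
        \<le> (\<Sum>j<J. (1/2) ^ Suc j * (4 * (ln (\<Xi> a) + 22 * real d * real (Suc j))))"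
      by (intro sum_mono mult_left_mono link pL) auto
    moreover have "\<dots> = 4 * ln (\<Xi> a) * (\<Sum>j<J. (1/2) ^ Suc j)
        + 88 * real d * (\<Sum>j<J. real (Suc j) * (1/2) ^ Suc j)"
      unfolding sum_distrib_left sum.distrib[symmetric] by (intro sum.cong) (auto simp: algebra_simps)
    moreover have "4 * ln (\<Xi> a) * (\<Sum>j<J. (1/2) ^ Suc j) \<le> 4 * ln (\<Xi> a) * 1"
      using \<Xi>1[of a] by (intro mult_left_mono sum_half_powers_le) auto
    moreover have "88 * real d * (\<Sum>j<J. real (Suc j) * (1/2) ^ Suc j) \<le> 88 * real d * 2"
      by (intro mult_left_mono sum_Suc_half_powers_le) auto
    ultimately show ?thesis by linarith
  qed
  have "\<Xi> \<in> borel_measurable ?P" unfolding \<Xi>_def by measurable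
  then show ?thesis using \<Xi>1 int bound by blast
qed

subsection \<open>Exponential moments of the Lipschitz constant\<close>

text \<open>The slope is linear in \<open>v\<close>, an inner product with a gradient
  \<open>z\<close>. Some net direction attains the norm of \<open>z\<close> up to the factor 2, so
  finitely many directions control all \<open>v\<close>.\<close>

lemma abs_slope_le:
  assumes S: "norming_net d S" and B: "\<And>w. w \<in> S \<Longrightarrow> 2 * slope d W a A w \<le> B"
  shows "\<bar>slope d W a A v\<bar> \<le> B * sqrt (\<Sum>j<d. (v j)\<^sup>2)"
proof -
  define z where "z j = (\<Sum>i\<in>A. a i * W (i, j))" for j
  have slope: "slope d W a A v = (\<Sum>j<d. v j * z j)" for v
    unfolding slope_def z_def sum_distrib_left by (subst sum.swap) (simp add: mult_ac)
  obtain w where "w \<in> S" "sqrt (\<Sum>j<d. (z j)\<^sup>2) \<le> 2 * (\<Sum>j<d. w j * z j)"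
    using S unfolding norming_net_def by blast
  with B[of w] have z: "sqrt (\<Sum>j<d. (z j)\<^sup>2) \<le> B" by (simp add: slope)
  have "\<bar>slope d W a A v\<bar> \<le> sqrt ((\<Sum>j<d. (v j)\<^sup>2) * (\<Sum>j<d. (z j)\<^sup>2))"
    unfolding slope real_sqrt_abs[symmetric] by (intro real_sqrt_le_mono Cauchy_Schwarz_ineq_sum)
  also have "\<dots> \<le> B * sqrt (\<Sum>j<d. (v j)\<^sup>2)"
    using mult_right_mono[OF z, of "sqrt (\<Sum>j<d. (v j)\<^sup>2)"]
    by (simp add: real_sqrt_mult mult.commute sum_nonneg)
  finally show ?thesis .
qed

lemma Lip_shallow_net_le:
  assumes "norming_net d S" "d \<ge> 1"
    and "\<And>x w. w \<in> S \<Longrightarrow> 2 * slope d W a (active d N W b x) w \<le> B"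
  shows "Lip d (shallow_net d N W b a c) \<le> B"
  using assms by (intro Lip_le shallow_net_diff_le abs_slope_le)

text \<open>A discretised operator norm of \<open>W\<close>.\<close>

definition net_norm ::
  "(nat \<Rightarrow> real) set \<Rightarrow> (nat \<Rightarrow> real) set \<Rightarrow> nat \<Rightarrow> nat \<Rightarrow> (nat \<times> nat \<Rightarrow> real) \<Rightarrow> real" where
  "net_norm S T d N W =
     Max ((\<lambda>(w, u). \<bar>\<Sum>i<N. u i * (\<Sum>j<d. W (i, j) * w j)\<bar>) ` (S \<times> T))"

lemma exp5_ge: "(48::real) \<le> exp 5"
proof -
  have "(48::real) \<le> (3/2) ^ 10" by (simp add: power_divide)
  also have "\<dots> \<le> exp (1/2) ^ 10"
    using exp_ge_add_one_self[of "1/2"] by (intro power_mono) auto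
  also have "\<dots> = exp 5" by (simp add: exp_of_nat_mult[symmetric])
  finally show ?thesis .
qed

lemma card_net_le_exp: "norming_net n R \<Longrightarrow> real (card R) \<le> exp (5 * real n)"
proof -
  assume "norming_net n R"
  then have "real (card R) \<le> real (48 ^ n)" unfolding norming_net_def by (simp only: of_nat_le_iff)
  also have "\<dots> \<le> exp 5 ^ n" using exp5_ge by (simp add: power_mono)
  finally show ?thesis by (simp add: exp_of_nat_mult[symmetric] mult.commute)
qed

text \<open>For \<open>X = 0\<close> the quotient is 0 by convention and \<open>R \<ge> 1\<close>
  suffices; otherwise \<open>576 = 24\<^sup>2\<close> absorbs the constant.\<close>

lemma exp_ratio_le_if_square_le:
  fixes l :: real
  assumes l: "0 \<le> l" and X: "0 \<le> X" and R: "R \<ge> 1"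
    and le: "l \<le> 24 * X * sqrt (ln R)"
  shows "exp ((l / X)\<^sup>2 / 576) \<le> R"
proof (cases "X = 0")
  case False
  then have "l / X \<le> 24 * sqrt (ln R)" using le X by (simp add: field_simps)
  then have "(l / X)\<^sup>2 \<le> (24 * sqrt (ln R))\<^sup>2" using l X by (intro power_mono) auto
  then have "(l / X)\<^sup>2 / 576 \<le> ln R" using R by (simp add: power_mult_distrib)
  then show ?thesis using R by (subst (asm) ln_ge_iff) auto
qed (use R in simp)

context
  fixes S T :: "(nat \<Rightarrow> real) set" and d N :: nat
  assumes S: "norming_net d S" and T: "norming_net N T" and d: "d \<ge> 1" and N: "N \<ge> 1"
begin

lemma norm_image_le_net_norm:
  assumes w: "w \<in> S"
  shows "sqrt (\<Sum>i<N. (\<Sum>j<d. W (i, j) * w j)\<^sup>2) \<le> 2 * net_norm S T d N W"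
proof -
  have "\<exists>u\<in>T. sqrt (\<Sum>i<N. (y i)\<^sup>2) \<le> 2 * (\<Sum>i<N. u i * y i)" for y
    using T unfolding norming_net_def by blast
  from this[of "\<lambda>i. \<Sum>j<d. W (i, j) * w j"] obtain u where u: "u \<in> T" "sqrt (\<Sum>i<N. (\<Sum>j<d. W (i, j) * w j)\<^sup>2)
      \<le> 2 * (\<Sum>i<N. u i * (\<Sum>j<d. W (i, j) * w j))"
    by blast
  have "\<bar>\<Sum>i<N. u i * (\<Sum>j<d. W (i, j) * w j)\<bar> \<le> net_norm S T d N W"
    unfolding net_norm_def using S T u w
    by (intro Max_ge) (auto simp: norming_net_def intro!: image_eqI[of _ _ "(w, u)"])
  with u show ?thesis by linarith
qed

lemma net_norm_nonneg: "0 \<le> net_norm S T d N W"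
proof -
  obtain w where "w \<in> S" using S by (auto simp: norming_net_def)
  have "0 \<le> sqrt (\<Sum>i<N. (\<Sum>j<d. W (i, j) * w j)\<^sup>2)" by (simp add: sum_nonneg)
  also have "\<dots> \<le> 2 * net_norm S T d N W" by (rule norm_image_le_net_norm) fact
  finally show ?thesis by simp
qed

text \<open>Cauchy-Schwarz over the neurons, regardless of the pattern; each of the two nets costs a
  factor 2. Besides driving the narrow case, it shows that the Lipschitz constant vanishes with
  \<open>net_norm\<close>.\<close>

lemma Lip_le_net_norm:
  "Lip d (shallow_net d N W b a c) \<le> 4 * net_norm S T d N W * sqrt (\<Sum>i<N. (a i)\<^sup>2)"
proof (rule Lip_shallow_net_le[OF S d])
  fix x w assume w: "w \<in> S"
  let ?A = "active d N W b x" and ?y = "\<lambda>i. \<Sum>j<d. W (i, j) * w j"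
  have fin: "finite ?A" using active_subset by (rule finite_subset) simp
  have "slope d W a ?A w \<le> sqrt ((\<Sum>i\<in>?A. a i * ?y i)\<^sup>2)" by (simp add: slope_def)
  also have "\<dots> \<le> sqrt ((\<Sum>i\<in>?A. (a i)\<^sup>2) * (\<Sum>i\<in>?A. (?y i)\<^sup>2))"
    by (intro real_sqrt_le_mono Cauchy_Schwarz_ineq_sum)
  also have "\<dots> \<le> sqrt ((\<Sum>i<N. (a i)\<^sup>2) * (\<Sum>i<N. (?y i)\<^sup>2))"
    using active_subset by (intro real_sqrt_le_mono mult_mono sum_mono2 sum_nonneg) auto
  also have "\<dots> \<le> sqrt (\<Sum>i<N. (a i)\<^sup>2) * (2 * net_norm S T d N W)"
    unfolding real_sqrt_mult using norm_image_le_net_norm[OF w]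
    by (intro mult_left_mono) (auto intro: sum_nonneg)
  finally show "2 * slope d W a ?A w \<le> 4 * net_norm S T d N W * sqrt (\<Sum>i<N. (a i)\<^sup>2)"
    by (simp add: mult_ac)
qed

lemma Lip_shallow_net_nonneg: "0 \<le> Lip d (shallow_net d N W b a c)"
  using shallow_net_Lipschitz Lip_nonneg[OF d] by metis

lemma exp_Lip_narrow:
  "(\<integral>\<^sup>+ a. ennreal (exp ((Lip d (shallow_net d N W b a c) / net_norm S T d N W)\<^sup>2 / 576))
      \<partial>(\<Pi>\<^sub>M i\<in>{..<N}. gaussian 0 1)) \<le> ennreal (exp (real N))"
proof -
  have "exp ((Lip d (shallow_net d N W b a c) / net_norm S T d N W)\<^sup>2 / 576)
      \<le> exp ((\<Sum>i<N. (a i)\<^sup>2) / 4)" for a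
  proof (rule exp_ratio_le_if_square_le[OF Lip_shallow_net_nonneg net_norm_nonneg])
    have nn: "0 \<le> (\<Sum>i<N. (a i)\<^sup>2)" by (simp add: sum_nonneg)
    then show "1 \<le> exp ((\<Sum>i<N. (a i)\<^sup>2) / 4)" by simp
    have "Lip d (shallow_net d N W b a c) \<le> 4 * net_norm S T d N W * sqrt (\<Sum>i<N. (a i)\<^sup>2)"
      by (rule Lip_le_net_norm)
    \<comment> \<open>The target \<open>24 * sqrt (ln R)\<close> is 12 times the norm of
      \<open>a\<close>, as \<open>ln R\<close> is a quarter of its square. The slack over 4 comes
      from sharing one constant with the wide case.\<close>
    also have "\<dots> \<le> 12 * net_norm S T d N W * sqrt (\<Sum>i<N. (a i)\<^sup>2)"
      using nn net_norm_nonneg by (intro mult_right_mono) auto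
    finally show "Lip d (shallow_net d N W b a c)
        \<le> 24 * net_norm S T d N W * sqrt (ln (exp ((\<Sum>i<N. (a i)\<^sup>2) / 4)))"
      by (simp add: real_sqrt_divide)
  qed
  then have "(\<integral>\<^sup>+ a. ennreal (exp ((Lip d (shallow_net d N W b a c) / net_norm S T d N W)\<^sup>2 / 576))
      \<partial>(\<Pi>\<^sub>M i\<in>{..<N}. gaussian 0 1))
      \<le> (\<integral>\<^sup>+ a. ennreal (exp ((\<Sum>i<N. (a i)\<^sup>2) / 4)) \<partial>(\<Pi>\<^sub>M i\<in>{..<N}. gaussian 0 1))"
    by (intro nn_integral_mono ennreal_leI)
  also have "\<dots> \<le> ennreal (exp (real N))" by (rule gaussian_vector_exp_square)
  finally show ?thesis .
qed

text \<open>Each net direction is chained separately for fixed \<open>W\<close> and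
  \<open>b\<close>. The union over at most \<open>48 ^ d\<close> directions costs
  \<open>exp (5 * d)\<close>, the same order as the chaining entropy; thus
  \<open>50 = 44 + 5 + 1\<close>, the last from the moment bound 2.\<close>

lemma exp_Lip_wide:
  "(\<integral>\<^sup>+ a. ennreal (exp ((Lip d (shallow_net d N W b a c) / net_norm S T d N W)\<^sup>2 / 576))
      \<partial>(\<Pi>\<^sub>M i\<in>{..<N}. gaussian 0 1)) \<le> ennreal (exp (50 * real d))"
proof -
  let ?P = "\<Pi>\<^sub>M i\<in>{..<N}. gaussian 0 1"
  define X where "X = net_norm S T d N W"
  have X: "X \<ge> 0" unfolding X_def by (rule net_norm_nonneg)
  define y where "y w i = (\<Sum>j<d. W (i, j) * w j)" for w i
  have y: "sqrt (\<Sum>i<N. (y w i)\<^sup>2) \<le> 2 * X" if "w \<in> S" for w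
    unfolding y_def X_def by (rule norm_image_le_net_norm[OF that])
  have "\<forall>w\<in>S. \<exists>\<Xi>. \<Xi> \<in> borel_measurable ?P \<and> (\<forall>a. \<Xi> a \<ge> (1::real)) \<and>
      (\<integral>\<^sup>+ a. ennreal (\<Xi> a) \<partial>?P) \<le> 2 \<and>
      (\<forall>x a. (\<Sum>i\<in>active d N W b x. a i * (y w i / (2 * X)))\<^sup>2 / 36 \<le> ln (\<Xi> a) + 44 * real d)"
  proof
    fix w assume w: "w \<in> S"
    have "(\<Sum>i<N. (y w i / (2 * X))\<^sup>2) = (sqrt (\<Sum>i<N. (y w i)\<^sup>2))\<^sup>2 / (2 * X)\<^sup>2"
      by (simp add: power_divide sum_divide_distrib sum_nonneg)
    also have "\<dots> \<le> (2 * X)\<^sup>2 / (2 * X)\<^sup>2"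
      using y[OF w] by (intro divide_right_mono power_mono) (auto intro: sum_nonneg)
    \<comment> \<open>Includes \<open>X = 0\<close>, where the quotient is 0.\<close>
    also have "\<dots> \<le> 1" by simp
    finally show "\<exists>\<Xi>. \<Xi> \<in> borel_measurable ?P \<and> (\<forall>a. \<Xi> a \<ge> (1::real)) \<and>
      (\<integral>\<^sup>+ a. ennreal (\<Xi> a) \<partial>?P) \<le> 2 \<and>
      (\<forall>x a. (\<Sum>i\<in>active d N W b x. a i * (y w i / (2 * X)))\<^sup>2 / 36 \<le> ln (\<Xi> a) + 44 * real d)"
      by (rule chaining[OF _ d])
  qed
  from bchoice[OF this] obtain \<Xi> where \<Xi>0: "\<forall>w\<in>S. \<Xi> w \<in> borel_measurable ?P \<and> (\<forall>a. \<Xi> w a \<ge> (1::real)) \<and>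
      (\<integral>\<^sup>+ a. ennreal (\<Xi> w a) \<partial>?P) \<le> 2 \<and>
      (\<forall>x a. (\<Sum>i\<in>active d N W b x. a i * (y w i / (2 * X)))\<^sup>2 / 36 \<le> ln (\<Xi> w a) + 44 * real d)"
    by blast
  then have \<Xi>: "\<And>w. w \<in> S \<Longrightarrow> \<Xi> w \<in> borel_measurable ?P" "\<And>w a. w \<in> S \<Longrightarrow> \<Xi> w a \<ge> (1::real)"
      "\<And>w. w \<in> S \<Longrightarrow> (\<integral>\<^sup>+ a. ennreal (\<Xi> w a) \<partial>?P) \<le> 2"
      "\<And>w x a. w \<in> S \<Longrightarrow>
        (\<Sum>i\<in>active d N W b x. a i * (y w i / (2 * X)))\<^sup>2 / 36 \<le> ln (\<Xi> w a) + 44 * real d"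
    by simp_all
  \<comment> \<open>The union bound in exponential form: \<open>R\<close> dominates all directions
    at once, and its integral is a plain sum.\<close>
  define R where "R a = exp (44 * real d) * (\<Sum>w\<in>S. \<Xi> w a)" for a
  have S': "finite S" "S \<noteq> {}" using S by (auto simp: norming_net_def)
  have nn: "0 \<le> \<Xi> w a" if "w \<in> S" for w a using \<Xi>(2)[OF that, of a] by simp
  have R: "exp (44 * real d) * \<Xi> w a \<le> R a" if "w \<in> S" for w a
    unfolding R_def using that S' nn by (intro mult_left_mono member_le_sum) auto
  have R1: "R a \<ge> 1" for a
  proof -
    obtain w where w: "w \<in> S" using S' by auto
    have "1 * 1 \<le> exp (44 * real d) * \<Xi> w a" using \<Xi>(2)[OF w] by (intro mult_mono) auto
    then show ?thesis using R[OF w, of a] by simp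
  qed
  have "exp ((Lip d (shallow_net d N W b a c) / X)\<^sup>2 / 576) \<le> R a" for a
  proof (rule exp_ratio_le_if_square_le[OF Lip_shallow_net_nonneg X R1])
    show "Lip d (shallow_net d N W b a c) \<le> 24 * X * sqrt (ln (R a))"
    proof (cases "X = 0")
      case True
      then show ?thesis using Lip_le_net_norm[of W b a c] by (simp add: X_def)
    next
      case False
      show ?thesis
      proof (rule Lip_shallow_net_le[OF S d])
        fix x w assume w: "w \<in> S"
        let ?A = "active d N W b x"
        define s where "s = (\<Sum>i\<in>?A. a i * (y w i / (2 * X)))"
        have "s\<^sup>2 / 36 \<le> ln (\<Xi> w a) + 44 * real d" unfolding s_def by (rule \<Xi>(4)[OF w])
        also have "\<dots> = ln (exp (44 * real d) * \<Xi> w a)"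
          using \<Xi>(2)[OF w, of a] by (subst ln_mult_pos) auto
        also have "\<dots> \<le> ln (R a)" using R[OF w, of a] \<Xi>(2)[OF w, of a] by (intro ln_mono) auto
        finally have "s\<^sup>2 \<le> 36 * ln (R a)" by simp
        then have "sqrt (s\<^sup>2) \<le> sqrt (36 * ln (R a))" by (rule real_sqrt_le_mono)
        then have "s \<le> 6 * sqrt (ln (R a))" by (simp add: real_sqrt_mult)
        then have "4 * X * s \<le> 4 * X * (6 * sqrt (ln (R a)))" using X by (intro mult_left_mono) auto
        moreover have "2 * slope d W a ?A w = 4 * X * s"
        proof -
          have "s = (\<Sum>i\<in>?A. a i * y w i) / (2 * X)"
            by (simp add: s_def sum_divide_distrib)
          also have "\<dots> = slope d W a ?A w / (2 * X)" by (simp add: slope_def y_def)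
          finally have "s = slope d W a ?A w / (2 * X)" .
          then show ?thesis using False by simp
        qed
        ultimately show "2 * slope d W a ?A w \<le> 24 * X * sqrt (ln (R a))" by simp
      qed
    qed
  qed
  then have "(\<integral>\<^sup>+ a. ennreal (exp ((Lip d (shallow_net d N W b a c) / X)\<^sup>2 / 576)) \<partial>?P)
      \<le> (\<integral>\<^sup>+ a. ennreal (R a) \<partial>?P)"
    by (intro nn_integral_mono ennreal_leI)
  also have "\<dots> = (\<integral>\<^sup>+ a. ennreal (exp (44 * real d)) * (\<Sum>w\<in>S. ennreal (\<Xi> w a)) \<partial>?P)"
    unfolding R_def using nn by (simp add: ennreal_mult sum_nonneg sum_ennreal)
  also have "\<dots> = ennreal (exp (44 * real d)) * (\<Sum>w\<in>S. \<integral>\<^sup>+ a. ennreal (\<Xi> w a) \<partial>?P)"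
    using \<Xi>(1) by (subst nn_integral_cmult) (auto simp: nn_integral_sum)
  also have "\<dots> \<le> ennreal (exp (44 * real d)) * (\<Sum>w\<in>S. 2)"
    using \<Xi>(3) by (intro mult_left_mono sum_mono) auto
  also have "(\<Sum>w\<in>S. 2) = ennreal (real (card S) * 2)"
    by (simp add: ennreal_mult ennreal_of_nat_eq_real_of_nat)
  also have "ennreal (exp (44 * real d)) * \<dots> = ennreal (exp (44 * real d) * (real (card S) * 2))"
    by (simp add: ennreal_mult)
  also have "\<dots> \<le> ennreal (exp (44 * real d) * (exp (5 * real d) * exp (real d)))"
  proof (intro ennreal_leI mult_left_mono mult_mono card_net_le_exp[OF S])
    show "2 \<le> exp (real d)" using exp_ge_add_one_self[of "real d"] of_nat_mono[OF d, where 'a=real] by linarith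
  qed auto
  also have "exp (44 * real d) * (exp (5 * real d) * exp (real d)) = exp (50 * real d)"
    by (simp add: exp_add[symmetric])
  finally show ?thesis by (simp add: X_def)
qed

lemma exp_Lip:
  "(\<integral>\<^sup>+ a. ennreal (exp ((Lip d (shallow_net d N W b a c) / net_norm S T d N W)\<^sup>2 / 576))
      \<partial>(\<Pi>\<^sub>M i\<in>{..<N}. gaussian 0 1)) \<le> ennreal (exp (50 * real (min d N)))"
proof (cases "d \<le> N")
  case True
  then show ?thesis using exp_Lip_wide[of W b c] by (simp add: min_absorb1)
next
  case False
  have "ennreal (exp (real N)) \<le> ennreal (exp (50 * real N))" by (intro ennreal_leI) simp
  then show ?thesis using exp_Lip_narrow[of W b c] False by (simp add: min_def order_trans)
qed

text \<open>The exponential of a maximum is at most the sum of the exponentials over all pairs of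
  net points. Each bilinear form has moment at most 2, and counting the pairs gives
  \<open>6 = 5 + 1\<close>.\<close>

lemma exp_net_norm:
  "(\<integral>\<^sup>+ W. ennreal (exp (real N * (net_norm S T d N W)\<^sup>2 / 8))
      \<partial>(\<Pi>\<^sub>M ij\<in>{..<N} \<times> {..<d}. gaussian 0 (sqrt (2 / real N)))) \<le> ennreal (exp (6 * (real N + real d)))"
proof -
  let ?I = "{..<N} \<times> {..<d}" and ?\<sigma> = "sqrt (2 / real N)"
  let ?P = "\<Pi>\<^sub>M ij\<in>?I. gaussian 0 ?\<sigma>"
  \<comment> \<open>\<open>sqrt (real N / 2)\<close> normalises entries of variance
    \<open>2 / N\<close>; squared and divided by 4 it yields the \<open>N / 8\<close> of the
    statement.\<close>
  define e where "e p ij = sqrt (real N / 2) * (snd p (fst ij) * fst p (snd ij))"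
    for p :: "(nat \<Rightarrow> real) \<times> (nat \<Rightarrow> real)" and ij :: "nat \<times> nat"
  define h where "h p W = exp ((\<Sum>ij\<in>?I. e p ij * W ij)\<^sup>2 / 4)" for p and W :: "nat \<times> nat \<Rightarrow> real"
  have h: "exp (real N * (\<Sum>i<N. snd p i * (\<Sum>j<d. W (i, j) * fst p j))\<^sup>2 / 8) = h p W" for p W
  proof -
    have "(\<Sum>ij\<in>?I. e p ij * W ij) = (\<Sum>i<N. \<Sum>j<d. e p (i, j) * W (i, j))"
      by (simp add: sum.cartesian_product split_beta)
    also have "\<dots> = sqrt (real N / 2) * (\<Sum>i<N. snd p i * (\<Sum>j<d. W (i, j) * fst p j))"
      by (simp add: e_def sum_distrib_left mult_ac)
    finally show ?thesis by (simp add: h_def power_mult_distrib)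
  qed
  have ST: "finite (S \<times> T)" "S \<times> T \<noteq> {}" using S T by (auto simp: norming_net_def)
  have "exp (real N * (net_norm S T d N W)\<^sup>2 / 8) \<le> (\<Sum>p\<in>S \<times> T. h p W)" for W
  proof -
    have "net_norm S T d N W \<in> (\<lambda>(w, u). \<bar>\<Sum>i<N. u i * (\<Sum>j<d. W (i, j) * w j)\<bar>) ` (S \<times> T)"
      unfolding net_norm_def using ST by (intro Max_in) auto
    then obtain p where p: "p \<in> S \<times> T"
      "net_norm S T d N W = \<bar>\<Sum>i<N. snd p i * (\<Sum>j<d. W (i, j) * fst p j)\<bar>" by auto
    then have "exp (real N * (net_norm S T d N W)\<^sup>2 / 8) = h p W" by (simp add: h)
    also have "\<dots> \<le> (\<Sum>p\<in>S \<times> T. h p W)" using ST p by (intro member_le_sum) (auto simp: h_def)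
    finally show ?thesis .
  qed
  then have "(\<integral>\<^sup>+ W. ennreal (exp (real N * (net_norm S T d N W)\<^sup>2 / 8)) \<partial>?P)
      \<le> (\<integral>\<^sup>+ W. ennreal (\<Sum>p\<in>S \<times> T. h p W) \<partial>?P)"
    by (intro nn_integral_mono ennreal_leI)
  also have "\<dots> = (\<integral>\<^sup>+ W. (\<Sum>p\<in>S \<times> T. ennreal (h p W)) \<partial>?P)"
    by (simp add: h_def)
  also have "\<dots> = (\<Sum>p\<in>S \<times> T. \<integral>\<^sup>+ W. ennreal (h p W) \<partial>?P)"
  proof (rule nn_integral_sum)
    fix p
    have [measurable]: "(\<lambda>W. \<Sum>ij\<in>?I. e p ij * W ij) \<in> borel_measurable ?P"
      by (intro borel_measurable_sum borel_measurable_times borel_measurable_const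
          measurable_PiM_gaussian_component)
    show "(\<lambda>W. ennreal (h p W)) \<in> borel_measurable ?P" unfolding h_def by measurable
  qed
  also have "\<dots> \<le> (\<Sum>p\<in>S \<times> T. 2)"
  proof (rule sum_mono)
    fix p assume p: "p \<in> S \<times> T"
    then have le: "(\<Sum>j<d. (fst p j)\<^sup>2) \<le> 1" "(\<Sum>i<N. (snd p i)\<^sup>2) \<le> 1"
      using S T by (auto simp: norming_net_def)
    have "(\<Sum>ij\<in>?I. (e p ij)\<^sup>2) = (\<Sum>i<N. \<Sum>j<d. (e p (i, j))\<^sup>2)"
      by (simp add: sum.cartesian_product split_beta)
    also have "\<dots> = (\<Sum>i<N. \<Sum>j<d. real N / 2 * ((snd p i)\<^sup>2 * (fst p j)\<^sup>2))"
      by (simp add: e_def power_mult_distrib)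
    also have "\<dots> = real N / 2 * (\<Sum>i<N. \<Sum>j<d. (snd p i)\<^sup>2 * (fst p j)\<^sup>2)"
      by (simp only: sum_distrib_left)
    also have "(\<Sum>i<N. \<Sum>j<d. (snd p i)\<^sup>2 * (fst p j)\<^sup>2) = (\<Sum>i<N. (snd p i)\<^sup>2) * (\<Sum>j<d. (fst p j)\<^sup>2)"
      by (rule sum_product[symmetric])
    finally have "(\<Sum>ij\<in>?I. (e p ij)\<^sup>2) * ?\<sigma>\<^sup>2 = (\<Sum>i<N. (snd p i)\<^sup>2) * (\<Sum>j<d. (fst p j)\<^sup>2)"
      using N by simp
    also have "\<dots> \<le> 1 * 1" using le by (intro mult_mono) (auto intro: sum_nonneg)
    finally show "(\<integral>\<^sup>+ W. ennreal (h p W) \<partial>?P) \<le> 2"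
      unfolding h_def using N by (intro gaussian_linear_form_exp_square) auto
  qed
  also have "\<dots> = ennreal (real (card S) * real (card T) * 2)"
    by (simp add: card_cartesian_product ennreal_mult ennreal_of_nat_eq_real_of_nat)
  also have "\<dots> \<le> ennreal (exp (5 * real d) * exp (5 * real N) * exp (real N + real d))"
  proof (intro ennreal_leI mult_mono card_net_le_exp S T)
    show "2 \<le> exp (real N + real d)" using exp_ge_add_one_self[of "real N + real d"]
        of_nat_mono[OF d, where 'a=real] of_nat_mono[OF N, where 'a=real] by linarith
  qed auto
  also have "exp (5 * real d) * exp (5 * real N) * exp (real N + real d) = exp (6 * (real N + real d))"
    by (simp add: exp_add[symmetric] algebra_simps)
  finally show ?thesis .
qed

end

subsection \<open>Tail bound and mean\<close>

lemma (in prob_space) exp_Markov: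
  fixes f :: "'a \<Rightarrow> real"
  assumes [measurable]: "f \<in> borel_measurable M"
    and le: "(\<integral>\<^sup>+ \<omega>. ennreal (exp (f \<omega>)) \<partial>M) \<le> ennreal (exp A)"
  shows "prob {\<omega> \<in> space M. A + s \<le> f \<omega>} \<le> exp (- s)"
proof -
  have "{\<omega> \<in> space M. A + s \<le> f \<omega>} = {\<omega> \<in> space M. 1 \<le> ennreal (exp (- (A + s))) * ennreal (exp (f \<omega>))}"
    by (auto simp: ennreal_mult[symmetric] exp_add[symmetric] ennreal_1[symmetric] simp del: ennreal_1)
  then have "emeasure M {\<omega> \<in> space M. A + s \<le> f \<omega>}
      \<le> ennreal (exp (- (A + s))) * (\<integral>\<^sup>+ \<omega>. ennreal (exp (f \<omega>)) * indicator (space M) \<omega> \<partial>M)"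
    by (simp only:) (rule nn_integral_Markov_inequality, measurable)
  also have "(\<integral>\<^sup>+ \<omega>. ennreal (exp (f \<omega>)) * indicator (space M) \<omega> \<partial>M) = (\<integral>\<^sup>+ \<omega>. ennreal (exp (f \<omega>)) \<partial>M)"
    by (intro nn_integral_cong) simp
  also have "ennreal (exp (- (A + s))) * \<dots> \<le> ennreal (exp (- (A + s))) * ennreal (exp A)"
    using le by (intro mult_left_mono) auto
  also have "\<dots> = ennreal (exp (- s))" by (simp add: ennreal_mult[symmetric] exp_add[symmetric])
  finally show ?thesis by (simp add: emeasure_eq_measure)
qed

text \<open>The tangent inequality \<open>1 + x \<le> exp x\<close> at
  \<open>x = f \<omega> - A\<close> replaces Jensen and stays within the non-negative integral,
  where integrability need not be known.\<close>

lemma (in prob_space) nn_integral_le_if_exp_moment: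
  fixes f :: "'a \<Rightarrow> real"
  assumes [measurable]: "f \<in> borel_measurable M" and A: "A \<ge> 0" and f: "\<And>\<omega>. f \<omega> \<ge> 0"
    and le: "(\<integral>\<^sup>+ \<omega>. ennreal (exp (f \<omega>)) \<partial>M) \<le> ennreal (exp A)"
  shows "(\<integral>\<^sup>+ \<omega>. ennreal (f \<omega>) \<partial>M) \<le> ennreal (A + 1)"
proof -
  have "f \<omega> \<le> A + exp (- A) * exp (f \<omega>)" for \<omega>
  proof -
    have "exp (- A) * exp (f \<omega>) = exp (f \<omega> - A)" by (simp add: exp_add[symmetric])
    then show ?thesis using exp_ge_add_one_self[of "f \<omega> - A"] by linarith
  qed
  then have "(\<integral>\<^sup>+ \<omega>. ennreal (f \<omega>) \<partial>M)
      \<le> (\<integral>\<^sup>+ \<omega>. ennreal A + ennreal (exp (- A)) * ennreal (exp (f \<omega>)) \<partial>M)"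
    using A by (intro nn_integral_mono) (simp add: ennreal_mult[symmetric] ennreal_plus[symmetric] ennreal_leI del: ennreal_plus)
  also have "\<dots> = ennreal A + ennreal (exp (- A)) * (\<integral>\<^sup>+ \<omega>. ennreal (exp (f \<omega>)) \<partial>M)"
    by (simp add: nn_integral_add nn_integral_cmult emeasure_space_1)
  also have "\<dots> \<le> ennreal A + ennreal (exp (- A)) * ennreal (exp A)"
    using le by (intro add_left_mono mult_left_mono) auto
  also have "\<dots> = ennreal (A + 1)"
    using A by (simp add: ennreal_mult[symmetric] exp_add[symmetric])
  finally show ?thesis .
qed

text \<open>If \<open>a\<close> or \<open>b\<close> exceeds 1/2 the truncated product is 0;
  otherwise the cross term \<open>4 * a * b\<close> is at most \<open>a + b\<close>. This turns a
  union bound into the product form suggested by independence.\<close>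

lemma one_minus_product_le:
  fixes a b :: real
  assumes "0 \<le> a" "0 \<le> b"
  shows "max 0 (1 - 2 * a) * max 0 (1 - 2 * b) \<le> max 0 (1 - (a + b))"
proof (cases "a \<le> 1/2 \<and> b \<le> 1/2")
  case True
  have "2 * a * b \<le> a" "2 * a * b \<le> b"
    using True assms mult_left_mono[of "2 * b" 1 a] mult_right_mono[of "2 * a" 1 b] by auto
  then have "(1 - 2 * a) * (1 - 2 * b) \<le> 1 - (a + b)" by (simp add: algebra_simps)
  then show ?thesis using True by (simp add: max_def)
qed (auto simp: max_def)

lemma add_squares_le_square_add:
  fixes x y z :: real
  assumes "0 \<le> x" "0 \<le> y" "0 \<le> z"
  shows "x\<^sup>2 + y\<^sup>2 + z\<^sup>2 \<le> (x + y + z)\<^sup>2"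
  using assms by (simp add: power2_eq_square algebra_simps)

text \<open>The mean dictates the constant, \<open>28 + 14688 \<le> 20000\<close>; the tail asks
  only for \<open>7 * 170\<close>.\<close>

lemma (in prob_space) product_tail_and_mean:
  fixes X Y L :: "'a \<Rightarrow> real" and n d k :: real
  assumes [measurable]: "X \<in> borel_measurable M" "Y \<in> borel_measurable M" "L \<in> borel_measurable M"
    and X: "\<And>\<omega>. 0 \<le> X \<omega>" and Y: "\<And>\<omega>. 0 \<le> Y \<omega>" and L: "\<And>\<omega>. L \<omega> \<le> X \<omega> * Y \<omega>"
    and n: "n \<ge> 1" and d: "d \<ge> 1" and k: "k \<ge> 1"
    and EX: "(\<integral>\<^sup>+ \<omega>. ennreal (exp (n * (X \<omega>)\<^sup>2 / 8)) \<partial>M) \<le> ennreal (exp (6 * (n + d)))"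
    and EY: "(\<integral>\<^sup>+ \<omega>. ennreal (exp ((Y \<omega>)\<^sup>2 / 576)) \<partial>M) \<le> ennreal (exp (50 * k))"
  shows "\<And>u t. 0 \<le> u \<Longrightarrow> 0 \<le> t \<Longrightarrow>
      max 0 (1 - 2 * exp (- (u\<^sup>2))) * max 0 (1 - 2 * exp (- (t\<^sup>2)))
      \<le> prob {\<omega> \<in> space M. L \<omega> \<le> 20000 * (1 + (sqrt d + t) / sqrt n) * (sqrt k + u)}"
    and "(\<integral>\<^sup>+ \<omega>. ennreal (L \<omega>) \<partial>M) \<le> ennreal (20000 * (1 + sqrt d / sqrt n) * sqrt k)"
proof -
  fix u t :: real assume u: "0 \<le> u" and t: "0 \<le> t"
  define A where "A = {\<omega> \<in> space M. 6 * (n + d) + t\<^sup>2 \<le> n * (X \<omega>)\<^sup>2 / 8}"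
  define B where "B = {\<omega> \<in> space M. 50 * k + u\<^sup>2 \<le> (Y \<omega>)\<^sup>2 / 576}"
  define G where "G = {\<omega> \<in> space M. L \<omega> \<le> 20000 * (1 + (sqrt d + t) / sqrt n) * (sqrt k + u)}"
  have [measurable]: "A \<in> events" "B \<in> events" "G \<in> events" unfolding A_def B_def G_def by measurable
  have A: "prob A \<le> exp (- (t\<^sup>2))" unfolding A_def by (rule exp_Markov[OF _ EX]) measurable
  have B: "prob B \<le> exp (- (u\<^sup>2))" unfolding B_def by (rule exp_Markov[OF _ EY]) measurable
  define a where "a = 1 + (sqrt d + t) / sqrt n"
  define b where "b = sqrt k + u"
  have a: "a \<ge> 0" "a = (sqrt n + sqrt d + t) / sqrt n" using n d t by (auto simp: a_def field_simps)
  have b: "b \<ge> 0" using k u by (simp add: b_def)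
  have na: "n * a\<^sup>2 \<ge> n + d + t\<^sup>2"
    using add_squares_le_square_add[of "sqrt n" "sqrt d" t] n d t by (simp add: a(2) power_divide)
  have kb: "b\<^sup>2 \<ge> k + u\<^sup>2"
    using add_squares_le_square_add[of "sqrt k" u 0] k u by (simp add: b_def)
  have "space M - G \<subseteq> A \<union> B"
  proof
    fix \<omega> assume \<omega>: "\<omega> \<in> space M - G"
    show "\<omega> \<in> A \<union> B"
    proof (rule ccontr)
      assume "\<omega> \<notin> A \<union> B"
      then have AB: "n * (X \<omega>)\<^sup>2 / 8 < 6 * (n + d) + t\<^sup>2" "(Y \<omega>)\<^sup>2 / 576 < 50 * k + u\<^sup>2"
        using \<omega> by (auto simp: A_def B_def)
      \<comment> \<open>\<open>8 * 6 = 48\<close> is rounded up to the square of 7, as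
        \<open>576 * 50 = 28800\<close> is to \<open>28900 = 170\<^sup>2\<close> below.\<close>
      have "n * (X \<omega>)\<^sup>2 \<le> 49 * (n * a\<^sup>2)" 
      proof -
        have "x \<le> 49 * y" if "x / 8 < 6 * (n + d) + z" "n + d + z \<le> y" "0 \<le> z" for x y z :: real
          using that n d by simp
        then show ?thesis using AB(1) na zero_le_power2 by blast
      qed
      then have "n * (X \<omega>)\<^sup>2 \<le> n * (7 * a)\<^sup>2" by (simp add: power_mult_distrib)
      then have "(X \<omega>)\<^sup>2 \<le> (7 * a)\<^sup>2" using n by simp
      then have X7: "X \<omega> \<le> 7 * a" by (rule power2_le_imp_le) (use a(1) in simp)
      have "(Y \<omega>)\<^sup>2 \<le> 28900 * b\<^sup>2" using AB(2) kb k zero_le_power2[of u] by linarith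
      then have "(Y \<omega>)\<^sup>2 \<le> (170 * b)\<^sup>2" by (simp add: power_mult_distrib)
      then have Y170: "Y \<omega> \<le> 170 * b" by (rule power2_le_imp_le) (use b in simp)
      have "L \<omega> \<le> (7 * a) * (170 * b)"
        using L[of \<omega>] mult_mono[OF X7 Y170] a(1) Y[of \<omega>] by auto
      also have "\<dots> \<le> 20000 * a * b" using a(1) b by simp
      finally show False using \<omega> by (simp add: G_def a_def b_def)
    qed
  qed
  then have "prob (space M - G) \<le> prob (A \<union> B)" by (intro finite_measure_mono) auto
  also have "\<dots> \<le> prob A + prob B" by (rule measure_Un_le) auto
  finally have "1 - (exp (- (u\<^sup>2)) + exp (- (t\<^sup>2))) \<le> prob G" using A B by (simp add: prob_compl)
  then have "max 0 (1 - (exp (- (u\<^sup>2)) + exp (- (t\<^sup>2)))) \<le> prob G" by simp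
  then show "max 0 (1 - 2 * exp (- (u\<^sup>2))) * max 0 (1 - 2 * exp (- (t\<^sup>2)))
      \<le> prob {\<omega> \<in> space M. L \<omega> \<le> 20000 * (1 + (sqrt d + t) / sqrt n) * (sqrt k + u)}"
    unfolding G_def by (rule order_trans[OF one_minus_product_le, rotated 2]) auto
next
  define a where "a = 1 + sqrt d / sqrt n"
  have a: "a \<ge> 1" "a = (sqrt n + sqrt d) / sqrt n" using n d by (auto simp: a_def field_simps)
  have na: "n + d \<le> n * a\<^sup>2"
    using add_squares_le_square_add[of "sqrt n" "sqrt d" 0] n d by (simp add: a(2) power_divide)
  \<comment> \<open>The moments bound the mean of \<open>X\<^sup>2\<close> by order
    \<open>a\<^sup>2\<close> and that of \<open>Y\<^sup>2\<close> by order \<open>k\<close>, so this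
    weight balances AM-GM at order \<open>a * sqrt k\<close>; \<open>p\<close> and \<open>r\<close>
    express the two terms through the exponents in \<open>EX\<close> and \<open>EY\<close>.\<close>
  define s where "s = sqrt k / a"
  have s: "s > 0" using a(1) k by (simp add: s_def)
  define p where "p = 4 * s / n"
  define r where "r = 288 / s"
  have pr: "p > 0" "r > 0" using s n by (auto simp: p_def r_def)
  have "L \<omega> \<le> p * (n * (X \<omega>)\<^sup>2 / 8) + r * ((Y \<omega>)\<^sup>2 / 576)" for \<omega>
  proof -
    have "0 \<le> (s * X \<omega> - Y \<omega>)\<^sup>2 / (2 * s)" using s by simp
    also have "\<dots> = s * (X \<omega>)\<^sup>2 / 2 + (Y \<omega>)\<^sup>2 / (2 * s) - X \<omega> * Y \<omega>"
      using s by (simp add: power2_eq_square field_simps)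
    finally have "X \<omega> * Y \<omega> \<le> s * (X \<omega>)\<^sup>2 / 2 + (Y \<omega>)\<^sup>2 / (2 * s)" by simp
    moreover have "p * (n * (X \<omega>)\<^sup>2 / 8) = s * (X \<omega>)\<^sup>2 / 2" "r * ((Y \<omega>)\<^sup>2 / 576) = (Y \<omega>)\<^sup>2 / (2 * s)"
      using n by (simp_all add: p_def r_def)
    ultimately show ?thesis using L[of \<omega>] by linarith
  qed
  then have "(\<integral>\<^sup>+ \<omega>. ennreal (L \<omega>) \<partial>M)
      \<le> (\<integral>\<^sup>+ \<omega>. ennreal p * ennreal (n * (X \<omega>)\<^sup>2 / 8) + ennreal r * ennreal ((Y \<omega>)\<^sup>2 / 576) \<partial>M)"
    using pr n by (intro nn_integral_mono)
      (simp add: ennreal_mult[symmetric] ennreal_plus[symmetric] ennreal_leI less_imp_le del: ennreal_plus)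
  also have "\<dots> = ennreal p * (\<integral>\<^sup>+ \<omega>. ennreal (n * (X \<omega>)\<^sup>2 / 8) \<partial>M)
      + ennreal r * (\<integral>\<^sup>+ \<omega>. ennreal ((Y \<omega>)\<^sup>2 / 576) \<partial>M)"
    by (simp add: nn_integral_add nn_integral_cmult)
  also have "\<dots> \<le> ennreal p * ennreal (6 * (n + d) + 1) + ennreal r * ennreal (50 * k + 1)"
    using n d k EX EY by (intro add_mono mult_left_mono nn_integral_le_if_exp_moment) auto
  also have "\<dots> = ennreal (p * (6 * (n + d) + 1) + r * (50 * k + 1))"
    using pr n d k by (subst (1 2) ennreal_mult[symmetric], simp_all del: ennreal_plus)
      (subst ennreal_plus[symmetric], simp_all del: ennreal_plus)
  also have "\<dots> \<le> ennreal (20000 * a * sqrt k)"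
  proof (rule ennreal_leI)
    have "p * (6 * (n + d) + 1) \<le> p * (7 * (n * a\<^sup>2))"
      using pr na n d by (intro mult_left_mono) (simp_all add: distrib_left)
    also have "\<dots> = 28 * a * sqrt k" using n a(1) by (simp add: p_def s_def power2_eq_square)
    finally have 1: "p * (6 * (n + d) + 1) \<le> 28 * (a * sqrt k)" by simp
    have "r * (50 * k + 1) \<le> r * (51 * k)" using pr k by (intro mult_left_mono) auto
    also have "\<dots> = 14688 * (a * (k / sqrt k))" by (simp add: r_def s_def)
    also have "k / sqrt k = sqrt k" using k by (simp add: real_div_sqrt)
    finally have "r * (50 * k + 1) \<le> 14688 * (a * sqrt k)" .
    moreover have "0 \<le> a * sqrt k" using a(1) k by simp
    ultimately show "p * (6 * (n + d) + 1) + r * (50 * k + 1) \<le> 20000 * a * sqrt k"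
      using 1 by linarith
  qed
  finally show "(\<integral>\<^sup>+ \<omega>. ennreal (L \<omega>) \<partial>M) \<le> ennreal (20000 * (1 + sqrt d / sqrt n) * sqrt k)"
    by (simp only: a_def)
qed

text \<open>By Fubini the moment of \<open>Y\<close> is integrated over the outer weights first,
  with inner weights and all biases fixed. The bound obtained does not depend on them, so
  integrating it over the bias laws changes nothing.\<close>

lemma net_lip_tail_and_mean:
  fixes d N :: nat and D0 :: "nat \<Rightarrow> real measure" and D1 :: "real measure"
  assumes d: "d \<ge> 1" and N: "N \<ge> 1"
    and D0: "\<forall>i<N. prob_space (D0 i) \<and> sets (D0 i) = sets borel"
    and D1: "prob_space D1" "sets D1 = sets borel"
  defines "M \<equiv> param_measure d N D0 D1" and "k \<equiv> min d N"
  shows "\<And>u t. 0 \<le> u \<Longrightarrow> 0 \<le> t \<Longrightarrow>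
      max 0 (1 - 2 * exp (- (u\<^sup>2))) * max 0 (1 - 2 * exp (- (t\<^sup>2)))
      \<le> measure M {\<omega> \<in> space M. net_lip d N \<omega> \<le>
          20000 * (1 + (sqrt (real d) + t) / sqrt (real N)) * (sqrt (real k) + u)}"
    and "(\<integral>\<^sup>+ \<omega>. ennreal (net_lip d N \<omega>) \<partial>M)
      \<le> ennreal (20000 * (1 + sqrt (real d) / sqrt (real N)) * sqrt (real k))"
proof -
  define PW where "PW = (\<Pi>\<^sub>M ij\<in>{..<N} \<times> {..<d}. gaussian 0 (sqrt (2 / real N)))"
  define Pb where "Pb = (\<Pi>\<^sub>M i\<in>{..<N}. D0 i)"
  define Pa where "Pa = (\<Pi>\<^sub>M i\<in>{..<N}. gaussian 0 1)"
  have M: "M = (PW \<Otimes>\<^sub>M Pb) \<Otimes>\<^sub>M (Pa \<Otimes>\<^sub>M D1)"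
    by (simp add: M_def param_measure_def PW_def Pb_def Pa_def)
  interpret PW: prob_space PW
    unfolding PW_def using N by (intro prob_space_PiM prob_space_gaussian) simp
  interpret Pa: prob_space Pa
    unfolding Pa_def by (intro prob_space_PiM prob_space_gaussian) simp
  interpret D1: prob_space D1 by (rule D1)
  \<comment> \<open>\<open>D0 i\<close> is arbitrary for \<open>i \<ge> N\<close>, so a Gaussian is
    substituted there to make every factor a probability measure.\<close>
  have "Pb = (\<Pi>\<^sub>M i\<in>{..<N}. if i < N then D0 i else gaussian 0 1)"
    unfolding Pb_def by (intro PiM_cong) auto
  moreover have "prob_space (\<Pi>\<^sub>M i\<in>{..<N}. if i < N then D0 i else gaussian 0 1)"
    using D0 by (intro prob_space_PiM) (auto intro: prob_space_gaussian)
  ultimately interpret Pb: prob_space Pb by simp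
  interpret Wb: pair_prob_space PW Pb ..
  interpret ac: pair_prob_space Pa D1 ..
  interpret all: pair_prob_space "PW \<Otimes>\<^sub>M Pb" "Pa \<Otimes>\<^sub>M D1" ..
  interpret prob_space M unfolding M by (rule all.P.prob_space_axioms)
  have sets: "sets PW = sets (\<Pi>\<^sub>M ij\<in>{..<N} \<times> {..<d}. borel)" "sets Pb = sets (\<Pi>\<^sub>M i\<in>{..<N}. borel)"
    "sets Pa = sets (\<Pi>\<^sub>M i\<in>{..<N}. borel)"
    using D0 unfolding PW_def Pb_def Pa_def by (auto intro!: sets_PiM_cong)
  have L[measurable]: "net_lip d N \<in> borel_measurable M"
    unfolding M by (rule net_lip_measurable[OF d sets D1(2)])
  obtain S T where S: "norming_net d S" and T: "norming_net N T"
    using exists_norming_net d N by blast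
  note net = S T d N
  define X where "X \<omega> = net_norm S T d N (fst (fst \<omega>))"
    for \<omega> :: "((nat \<times> nat \<Rightarrow> real) \<times> (nat \<Rightarrow> real)) \<times> ((nat \<Rightarrow> real) \<times> real)"
  define Y where "Y \<omega> = net_lip d N \<omega> / X \<omega>" for \<omega>
  have ST: "finite (S \<times> T)" using S T by (auto simp: norming_net_def)
  have normW: "net_norm S T d N \<in> borel_measurable PW"
    unfolding net_norm_def split_beta PW_def
    by (intro borel_measurable_Max ST borel_measurable_abs borel_measurable_sum borel_measurable_times
        borel_measurable_const measurable_PiM_gaussian_component) auto
  have X[measurable]: "X \<in> borel_measurable M"
    unfolding X_def M by (intro measurable_compose[OF _ normW] measurable_compose[OF measurable_fst]) measurable
  have Y[measurable]: "Y \<in> borel_measurable M" unfolding Y_def by measurable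
  have X0: "0 \<le> X \<omega>" for \<omega> unfolding X_def by (rule net_norm_nonneg[OF net])
  have Y0: "0 \<le> Y \<omega>" for \<omega> unfolding Y_def using X0 net_lip_nonneg[OF d] by simp
  \<comment> \<open>Where \<open>X\<close> vanishes, \<open>Y\<close> is 0 by convention, and the
    Lipschitz constant has to vanish as well.\<close>
  have LXY: "net_lip d N \<omega> \<le> X \<omega> * Y \<omega>" for \<omega>
  proof (cases "X \<omega> = 0")
    case True
    then show ?thesis
      using Lip_le_net_norm[OF net, where W="fst (fst \<omega>)" and b="snd (fst \<omega>)"
          and a="fst (snd \<omega>)" and c="snd (snd \<omega>)"]
      by (simp add: X_def net_lip_def split_beta)
  qed (simp add: Y_def)
  have EX: "(\<integral>\<^sup>+ \<omega>. ennreal (exp (real N * (X \<omega>)\<^sup>2 / 8)) \<partial>M) \<le> ennreal (exp (6 * (real N + real d)))"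
  proof -
    have "(\<integral>\<^sup>+ \<omega>. ennreal (exp (real N * (X \<omega>)\<^sup>2 / 8)) \<partial>M)
        = (\<integral>\<^sup>+ Wb. \<integral>\<^sup>+ ac. ennreal (exp (real N * (X (Wb, ac))\<^sup>2 / 8)) \<partial>(Pa \<Otimes>\<^sub>M D1) \<partial>(PW \<Otimes>\<^sub>M Pb))"
      unfolding M by (rule ac.nn_integral_fst[symmetric]) (use X in \<open>simp add: M\<close>)
    also have "\<dots> = (\<integral>\<^sup>+ Wb. ennreal (exp (real N * (net_norm S T d N (fst Wb))\<^sup>2 / 8)) \<partial>(PW \<Otimes>\<^sub>M Pb))"
      by (simp add: X_def ac.emeasure_space_1)
    also have "\<dots> = (\<integral>\<^sup>+ W. \<integral>\<^sup>+ b. ennreal (exp (real N * (net_norm S T d N (fst (W, b)))\<^sup>2 / 8)) \<partial>Pb \<partial>PW)"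
    proof (rule Pb.nn_integral_fst[symmetric])
      have [measurable]: "(\<lambda>Wb. net_norm S T d N (fst Wb)) \<in> borel_measurable (PW \<Otimes>\<^sub>M Pb)"
        by (rule measurable_compose[OF measurable_fst normW])
      show "(\<lambda>Wb. ennreal (exp (real N * (net_norm S T d N (fst Wb))\<^sup>2 / 8)))
          \<in> borel_measurable (PW \<Otimes>\<^sub>M Pb)" by measurable
    qed
    also have "\<dots> = (\<integral>\<^sup>+ W. ennreal (exp (real N * (net_norm S T d N W)\<^sup>2 / 8)) \<partial>PW)"
      by (simp add: Pb.emeasure_space_1)
    also have "\<dots> \<le> ennreal (exp (6 * (real N + real d)))"
      unfolding PW_def by (rule exp_net_norm[OF net])
    finally show ?thesis .
  qed
  have EY: "(\<integral>\<^sup>+ \<omega>. ennreal (exp ((Y \<omega>)\<^sup>2 / 576)) \<partial>M) \<le> ennreal (exp (50 * real k))"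
  proof -
    have "(\<integral>\<^sup>+ \<omega>. ennreal (exp ((Y \<omega>)\<^sup>2 / 576)) \<partial>M)
        = (\<integral>\<^sup>+ Wb. \<integral>\<^sup>+ ac. ennreal (exp ((Y (Wb, ac))\<^sup>2 / 576)) \<partial>(Pa \<Otimes>\<^sub>M D1) \<partial>(PW \<Otimes>\<^sub>M Pb))"
      unfolding M by (rule ac.nn_integral_fst[symmetric]) (use Y in \<open>simp add: M\<close>)
    also have "\<dots> \<le> (\<integral>\<^sup>+ Wb. ennreal (exp (50 * real k)) \<partial>(PW \<Otimes>\<^sub>M Pb))"
    proof (rule nn_integral_mono)
      fix Wb assume Wb: "Wb \<in> space (PW \<Otimes>\<^sub>M Pb)"
      have [measurable]: "(\<lambda>ac. Y (Wb, ac)) \<in> borel_measurable (Pa \<Otimes>\<^sub>M D1)"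
        using Y Wb unfolding M by (rule measurable_Pair2)
      have "(\<integral>\<^sup>+ ac. ennreal (exp ((Y (Wb, ac))\<^sup>2 / 576)) \<partial>(Pa \<Otimes>\<^sub>M D1))
          = (\<integral>\<^sup>+ c. \<integral>\<^sup>+ a. ennreal (exp ((Y (Wb, (a, c)))\<^sup>2 / 576)) \<partial>Pa \<partial>D1)"
        by (rule ac.nn_integral_snd[symmetric]) measurable
      also have "\<dots> \<le> (\<integral>\<^sup>+ c. ennreal (exp (50 * real k)) \<partial>D1)"
        unfolding k_def Y_def X_def net_lip_def split_beta Pa_def fst_conv snd_conv
        by (intro nn_integral_mono exp_Lip[OF net])
      also have "\<dots> = ennreal (exp (50 * real k))" by (simp add: D1.emeasure_space_1)
      finally show "(\<integral>\<^sup>+ ac. ennreal (exp ((Y (Wb, ac))\<^sup>2 / 576)) \<partial>(Pa \<Otimes>\<^sub>M D1))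
          \<le> ennreal (exp (50 * real k))" .
    qed
    also have "\<dots> = ennreal (exp (50 * real k))" by (simp add: Wb.emeasure_space_1)
    finally show ?thesis .
  qed
  have pos: "real N \<ge> 1" "real d \<ge> 1" "real k \<ge> 1" using d N by (auto simp: k_def)
  note bounds = product_tail_and_mean[OF X Y L X0 Y0 LXY pos EX EY]
  show "max 0 (1 - 2 * exp (- (u\<^sup>2))) * max 0 (1 - 2 * exp (- (t\<^sup>2)))
      \<le> measure M {\<omega> \<in> space M. net_lip d N \<omega> \<le>
          20000 * (1 + (sqrt (real d) + t) / sqrt (real N)) * (sqrt (real k) + u)}"
    if "0 \<le> u" "0 \<le> t" for u t
    using that by (rule bounds(1))
  show "(\<integral>\<^sup>+ \<omega>. ennreal (net_lip d N \<omega>) \<partial>M)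
      \<le> ennreal (20000 * (1 + sqrt (real d) / sqrt (real N)) * sqrt (real k))"
    by (rule bounds(2))
qed

theorem theorem5p6:
  shows "\<exists>C c1 :: real. C > 0 \<and> c1 > 0 \<and>
    (\<forall>(d::nat) (N::nat) (D0 :: nat \<Rightarrow> real measure) (D1 :: real measure).
       d \<ge> 1 \<longrightarrow> N \<ge> 1 \<longrightarrow>
       (\<forall>i<N. prob_space (D0 i) \<and> sets (D0 i) = sets borel) \<longrightarrow>
       prob_space D1 \<longrightarrow> sets D1 = sets borel \<longrightarrow>
       (let M = param_measure d N D0 D1; k = min d N in
         (\<forall>u t :: real. u \<ge> 0 \<longrightarrow> t \<ge> 0 \<longrightarrow>
            measure M {\<omega> \<in> space M. net_lip d N \<omega> \<le>
                 C * (1 + (sqrt (real d) + t) / sqrt (real N)) * (sqrt (real k) + u)}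
            \<ge> max 0 (1 - 2 * exp (- (u^2))) * max 0 (1 - 2 * exp (- c1 * t^2)))
         \<and> (\<integral>\<^sup>+ \<omega>. ennreal (net_lip d N \<omega>) \<partial>M)
              \<le> ennreal (C * (1 + sqrt (real d) / sqrt (real N)) * sqrt (real k))))"
proof (rule exI[of _ 20000], rule exI[of _ 1], intro conjI allI impI)
  fix d N :: nat and D0 :: "nat \<Rightarrow> real measure" and D1 :: "real measure"
  assume d: "d \<ge> 1" and N: "N \<ge> 1" and D: "\<forall>i<N. prob_space (D0 i) \<and> sets (D0 i) = sets borel"
    "prob_space D1" "sets D1 = sets borel"
  show "let M = param_measure d N D0 D1; k = min d N in
         (\<forall>u t :: real. u \<ge> 0 \<longrightarrow> t \<ge> 0 \<longrightarrow>
            measure M {\<omega> \<in> space M. net_lip d N \<omega> \<le>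
                 20000 * (1 + (sqrt (real d) + t) / sqrt (real N)) * (sqrt (real k) + u)}
            \<ge> max 0 (1 - 2 * exp (- (u^2))) * max 0 (1 - 2 * exp (- 1 * t^2)))
         \<and> (\<integral>\<^sup>+ \<omega>. ennreal (net_lip d N \<omega>) \<partial>M)
              \<le> ennreal (20000 * (1 + sqrt (real d) / sqrt (real N)) * sqrt (real k))"
    using net_lip_tail_and_mean[OF d N D] by (simp add: Let_def)
qed auto

end
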